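(* With the \textsc{Like} mechanism and general (rational non-negative) utilities, for any number of agents, the problem \textsc{ExactUtility} is solvable in polynomial time. Here \textsc{ExactUtility} is the problem: given an instance $\mathcal{I}=(A,O,U,o)$ with fixed arrival ordering $o$ and an agent $a_i\in A$, output the expected utility $u_{im}(o)$.
   Context: Instances. An instance $\mathcal{I}=(A,O,U,o)$ consists of a set $A=\{a_1,\dots,a_n\}$ of agents, a set $O=\{o_1,\dots,o_m\}$ of indivisible items, rational non-negative utilities $u_{ik}$ of agent $a_i$ for item $o_k$ (collected in $U$), and a known ordering $o$ of the $m$ items in which they arrive one at a time. Agents bid sincerely, i.e. agent $a_i$ bids $v_{ik}=u_{ik}$ for item $o_k$. Utilities are additive. \textsc{Like} mechanism. Each arriving item $o_k$ is allocated immediately and irrevocably to an agent chosen uniformly at random among the agents $a_i$ with $v_{ik}>0$; if there are none, nobody receives it. Expected utility. $u_{im}(o)=\sum_{\pi}p(\pi)\,u_i(\pi)$, where $\pi$ ranges over the allocations of the $m$ items that the mechanism can produce when they arrive in the order $o$, $p(\pi)$ is the probability of $\pi$, and $u_i(\pi)$ is the sum of the utilities of $a_i$ for the items it receives in $\pi$. *)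

theory Defs
  imports
    "HOL-Probability.Probability"
    "HOL-Computational_Algebra.Polynomial"
begin

section \<open>Deterministic multi-tape Turing machines\<close>

text \<open>
  States are \<open>0, \<dots>, states M\<close>, with start state \<open>0\<close> and halting state \<open>states M\<close>. Tape symbols
  are \<open>0, \<dots>, symbols M - 1\<close>, where \<open>0\<close> is the blank. Tapes are infinite in both directions.
\<close>

datatype direction = Left | Stay | Right

record tm =
  tapes :: nat
  states :: nat
  symbols :: nat
  delta :: "nat \<Rightarrow> nat list \<Rightarrow> nat \<times> (nat \<times> direction) list"

type_synonym tape = "int \<times> (int \<Rightarrow> nat)"
type_synonym config = "nat \<times> tape list"
type_synonym word = "nat list"

text \<open>
  The symbols \<open>1, \<dots>, 5\<close>, used below to write inputs and outputs, belong to every tape alphabet.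
\<close>

definition wf_tm :: "tm \<Rightarrow> bool" where
  "wf_tm M \<longleftrightarrow> tapes M \<ge> 1 \<and> symbols M \<ge> 6 \<and>
    (\<forall>q < states M. \<forall>ss. length ss = tapes M \<and> set ss \<subseteq> {..<symbols M} \<longrightarrow>
      fst (delta M q ss) \<le> states M \<and>
      length (snd (delta M q ss)) = tapes M \<and>
      fst ` set (snd (delta M q ss)) \<subseteq> {..<symbols M})"

fun shift :: "direction \<Rightarrow> int" where
  "shift Left = -1"
| "shift Stay = 0"
| "shift Right = 1"

fun act :: "nat \<times> direction \<Rightarrow> tape \<Rightarrow> tape" where
  "act (a, d) (h, t) = (h + shift d, t(h := a))"

fun tm_step :: "tm \<Rightarrow> config \<Rightarrow> config" where
  "tm_step M (q, ts) =
    (if q < states M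
     then let (q', acts) = delta M q (map (\<lambda>(h, t). t h) ts) in (q', map2 act acts ts)
     else (q, ts))"

definition word_tape :: "word \<Rightarrow> int \<Rightarrow> nat" where
  "word_tape w p = (if 0 \<le> p \<and> p < int (length w) then w ! nat p else 0)"

text \<open>The input is written on the first tape and the output is read off the last one.\<close>

definition init_config :: "tm \<Rightarrow> word \<Rightarrow> config" where
  "init_config M w = (0, (0, word_tape w) # replicate (tapes M - 1) (0, word_tape []))"

definition computes_within :: "tm \<Rightarrow> nat \<Rightarrow> word \<Rightarrow> word \<Rightarrow> bool" where
  "computes_within M T w v \<longleftrightarrow>
    (\<exists>t \<le> T. \<exists>ts. (tm_step M ^^ t) (init_config M w) = (states M, ts) \<and>
      snd (last ts) = word_tape v)"

text \<open>
  Encodings are relations between words and objects, since an object may have several codes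
  (a rational number is represented by any of its fractions). The machine has to work for
  every code of the input and may produce any code of the result.
\<close>

definition poly_time_computable ::
    "(word \<Rightarrow> 'a \<Rightarrow> bool) \<Rightarrow> (word \<Rightarrow> 'b \<Rightarrow> bool) \<Rightarrow> 'a set \<Rightarrow> ('a \<Rightarrow> 'b) \<Rightarrow> bool" where
  "poly_time_computable in_code out_code D f \<longleftrightarrow>
    (\<exists>M. \<exists>p :: nat poly. wf_tm M \<and>
      (\<forall>x \<in> D. \<forall>w. in_code w x \<longrightarrow>
        (\<exists>v. out_code v (f x) \<and> computes_within M (poly p (length w)) w v)))"


section \<open>Instances and the \textsc{Like} mechanism\<close>

text \<open>Agents are \<open>0, \<dots>, n - 1\<close> and items are \<open>0, \<dots>, m - 1\<close>.\<close>

record alloc_instance =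
  num_agents :: nat
  num_items :: nat
  util :: "nat \<Rightarrow> nat \<Rightarrow> rat"
  arrival :: "nat list"

definition wf_instance :: "alloc_instance \<Rightarrow> bool" where
  "wf_instance I \<longleftrightarrow>
    (\<forall>i < num_agents I. \<forall>k < num_items I. util I i k \<ge> 0) \<and>
    distinct (arrival I) \<and> set (arrival I) = {..<num_items I}"

text \<open>An allocation maps every item to its recipient, if there is one.\<close>

type_synonym allocation = "nat \<Rightarrow> nat option"

definition bidders :: "nat \<Rightarrow> (nat \<Rightarrow> nat \<Rightarrow> rat) \<Rightarrow> nat \<Rightarrow> nat set" where
  "bidders n v k = {i. i < n \<and> v i k > 0}"

definition like_item :: "nat \<Rightarrow> (nat \<Rightarrow> nat \<Rightarrow> rat) \<Rightarrow> nat \<Rightarrow> nat option pmf" where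
  "like_item n v k =
    (if bidders n v k = {} then return_pmf None
     else map_pmf Some (pmf_of_set (bidders n v k)))"

primrec like_run ::
    "nat \<Rightarrow> (nat \<Rightarrow> nat \<Rightarrow> rat) \<Rightarrow> nat list \<Rightarrow> allocation \<Rightarrow> allocation pmf" where
  "like_run n v [] \<pi> = return_pmf \<pi>"
| "like_run n v (k # ks) \<pi> = bind_pmf (like_item n v k) (\<lambda>r. like_run n v ks (\<pi>(k := r)))"

text \<open>Agents bid sincerely, so the bids are the utilities.\<close>

definition like :: "alloc_instance \<Rightarrow> allocation pmf" where
  "like I = like_run (num_agents I) (util I) (arrival I) (\<lambda>_. None)"

definition alloc_util :: "alloc_instance \<Rightarrow> nat \<Rightarrow> allocation \<Rightarrow> rat" where
  "alloc_util I i \<pi> = (\<Sum>k | k < num_items I \<and> \<pi> k = Some i. util I i k)"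

definition expected_util :: "alloc_instance \<Rightarrow> nat \<Rightarrow> real" where
  "expected_util I i = (\<Sum>\<pi> \<in> set_pmf (like I). pmf (like I) \<pi> * of_rat (alloc_util I i \<pi>))"


section \<open>The problem \textsc{ExactUtility}\<close>

text \<open>Input and output alphabet: the two binary digits and three punctuation symbols.\<close>

definition digit :: "nat \<Rightarrow> nat" where "digit b = b + 1"
definition slash :: nat where "slash = 3"
definition comma :: nat where "comma = 4"
definition semicolon :: nat where "semicolon = 5"

text \<open>Binary notation, most significant digit first.\<close>

fun binary :: "nat \<Rightarrow> word" where
  "binary a = (if a < 2 then [digit a] else binary (a div 2) @ [digit (a mod 2)])"

declare binary.simps [simp del]

definition rat_code :: "word \<Rightarrow> rat \<Rightarrow> bool" where
  "rat_code w q \<longleftrightarrow>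
    (\<exists>a b. b > 0 \<and> q = of_nat a / of_nat b \<and> w = binary a @ [slash] @ binary b)"

definition real_code :: "word \<Rightarrow> real \<Rightarrow> bool" where
  "real_code w x \<longleftrightarrow> (\<exists>q. x = of_rat q \<and> rat_code w q)"

text \<open>
  The code of an instance and an agent lists the agent, the arrival ordering, and the rows of
  the utility matrix; \<open>W j k\<close> is the chosen code of the utility of agent \<open>j\<close> for item \<open>k\<close>.
  The numbers of agents and items are determined by the shape of the matrix and the ordering.
\<close>

definition instance_code :: "word \<Rightarrow> alloc_instance \<times> nat \<Rightarrow> bool" where
  "instance_code w = (\<lambda>(I, i).
    \<exists>W. (\<forall>j < num_agents I. \<forall>k < num_items I. rat_code (W j k) (util I j k)) \<and>
      w = binary i @ [semicolon] @
          concat (map (\<lambda>k. binary k @ [comma]) (arrival I)) @ [semicolon] @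
          concat (map (\<lambda>j. concat (map (\<lambda>k. W j k @ [comma]) [0..<num_items I]) @ [semicolon])
            [0..<num_agents I]))"

definition exact_utility_inputs :: "(alloc_instance \<times> nat) set" where
  "exact_utility_inputs = {(I, i). wf_instance I \<and> i < num_agents I}"

definition exact_utility :: "alloc_instance \<times> nat \<Rightarrow> real" where
  "exact_utility = (\<lambda>(I, i). expected_util I i)"

lemma rat_code_exists:
  assumes "q \<ge> 0"
  shows "\<exists>w. rat_code w q"
proof -
  obtain a b where ab: "quotient_of q = (a, b)" by fastforce
  then have b: "b > 0" and q: "q = of_int a / of_int b"
    by (auto simp: quotient_of_denom_pos quotient_of_div)
  with assms have "a \<ge> 0" by (simp add: zero_le_divide_iff)
  with b q have "q = of_nat (nat a) / of_nat (nat b)" "nat b > 0" by auto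
  then show ?thesis unfolding rat_code_def by blast
qed

lemma instance_code_exists:
  assumes "x \<in> exact_utility_inputs"
  shows "\<exists>w. instance_code w x"
proof -
  obtain I i where x: "x = (I, i)" "wf_instance I"
    using assms by (auto simp: exact_utility_inputs_def)
  define W where "W = (\<lambda>j k. SOME w. rat_code w (util I j k))"
  have "\<forall>j < num_agents I. \<forall>k < num_items I. rat_code (W j k) (util I j k)"
    using x(2) unfolding wf_instance_def W_def by (metis rat_code_exists someI_ex)
  then show ?thesis unfolding instance_code_def x by auto
qed

end

(*
  Compile structured programs over finitely many stacks, one per tape, to Turing machines whose
  states are the residual commands of the program. By linearity, the expected utility is the sum
  of u_ik / c_k over the items k, where c_k is the number of bidders for k, so one pass over the
  matrix suffices to count the bidders of each column and to extract the row of the agent. The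
  fractions are then added over the product of their denominators, which is not reduced: its
  length is at most the sum of the lengths of the factors.
*)

theory Submission
  imports Defs
begin

section \<open>Structured commands\<close>

text \<open>The defining sum ranges over up to n^m allocations, so it cannot be evaluated term by
  term. Linearity helps because the draw for an item ignores all earlier draws, which makes the
  marginal of each item explicit. Quantities are represented according to their size: the agent, the
  number of items and the numbers of bidders are at most the input length and are kept in unary,
  whereas numerators and denominators can be exponential in it and are kept in binary. Leaving the
  sum unreduced is legitimate because \<open>rat_code\<close> accepts every fraction of the right
  value, so no gcd is computed. With input length \<open>h\<close>, each share brings in factors of
  at most \<open>2 * h + 1\<close> digits, so all numbers have length quadratic in \<open>h\<close>.
  Hence a single quadratic bound \<open>L\<close> serves every loop of the program, inner loops of
  the arithmetic included.\<close>

datatype 'r cmd =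
    Skip
  | Act "('r \<Rightarrow> nat) \<Rightarrow> 'r \<Rightarrow> nat \<times> direction"
  | Seq "'r cmd" "'r cmd" (infixr ";;" 60)
  | If "('r \<Rightarrow> nat) \<Rightarrow> bool" "'r cmd" "'r cmd"
  | While "('r \<Rightarrow> nat) \<Rightarrow> bool" "'r cmd"

definition keep :: "('r \<Rightarrow> nat) \<Rightarrow> 'r \<Rightarrow> nat \<times> direction" where
  "keep r s = (r s, Stay)"

text \<open>Control moves, such as entering a branch, also take a step, with \<open>keep\<close> as
  a no-op on the tapes. Command steps therefore match machine steps one to one.\<close>

fun next_cmd :: "'r cmd \<Rightarrow> ('r \<Rightarrow> nat) \<Rightarrow> 'r cmd \<times> ('r \<Rightarrow> nat \<times> direction)" where
  "next_cmd Skip r = (Skip, keep r)"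
| "next_cmd (Act f) r = (Skip, f r)"
| "next_cmd (c ;; d) r =
    (if c = Skip then (d, keep r) else (fst (next_cmd c r) ;; d, snd (next_cmd c r)))"
| "next_cmd (If b c d) r = (if b r then c else d, keep r)"
| "next_cmd (While b c) r = (if b r then c ;; While b c else Skip, keep r)"

definition tops :: "('r \<Rightarrow> tape) \<Rightarrow> 'r \<Rightarrow> nat" where
  "tops ts s = snd (ts s) (fst (ts s))"

definition apply_act :: "('r \<Rightarrow> nat \<times> direction) \<Rightarrow> ('r \<Rightarrow> tape) \<Rightarrow> 'r \<Rightarrow> tape" where
  "apply_act f ts s = act (f s) (ts s)"

fun cmd_step :: "'r cmd \<times> ('r \<Rightarrow> tape) \<Rightarrow> 'r cmd \<times> ('r \<Rightarrow> tape)" where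
  "cmd_step (c, ts) = (fst (next_cmd c (tops ts)), apply_act (snd (next_cmd c (tops ts))) ts)"

lemma apply_keep [simp]: "apply_act (keep (tops ts)) ts = ts"
proof
  fix s
  show "apply_act (keep (tops ts)) ts s = ts s"
    by (cases "ts s") (simp add: apply_act_def keep_def tops_def)
qed

subsection \<open>Weakest preconditions and running time\<close>

text \<open>
  In \<open>wp L\<close> no loop may iterate more than \<open>L\<close> times. This makes the running time of a command a
  polynomial in \<open>L\<close> that can be read off its syntax, so that no time needs to be tracked.
\<close>

primrec wp :: "nat \<Rightarrow> 'r cmd \<Rightarrow> (('r \<Rightarrow> tape) \<Rightarrow> bool) \<Rightarrow> ('r \<Rightarrow> tape) \<Rightarrow> bool" where
  "wp L Skip Q = Q"
| "wp L (Act f) Q = (\<lambda>ts. Q (apply_act (f (tops ts)) ts))"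
| "wp L (c ;; d) Q = wp L c (wp L d Q)"
| "wp L (If b c d) Q = (\<lambda>ts. if b (tops ts) then wp L c Q ts else wp L d Q ts)"
| "wp L (While b c) Q =
    ((\<lambda>R ts. if b (tops ts) then wp L c R ts else Q ts) ^^ Suc L) (\<lambda>_. False)"

text \<open>An iteration costs two steps besides its body: one to enter it and one to discard the
  finished \<open>Skip\<close>. The final \<open>1\<close> is the failing test. The branches of
  \<open>If\<close> are added because a maximum of polynomials need not be a polynomial.\<close>

primrec cost :: "nat \<Rightarrow> 'r cmd \<Rightarrow> nat" where
  "cost L Skip = 0"
| "cost L (Act f) = 1"
| "cost L (c ;; d) = cost L c + cost L d + 1"
| "cost L (If b c d) = cost L c + cost L d + 1"
| "cost L (While b c) = L * (cost L c + 2) + 1"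

text \<open>The command is fixed, so the bound \<open>poly q n\<close> is multiplied in once per
  nested loop and the degree depends on the nesting depth alone.\<close>

lemma cost_poly: "\<exists>p :: nat poly. \<forall>n. cost (poly q n) c = poly p n"
proof (induction c)
  case Skip
  show ?case by (rule exI[of _ 0]) simp
next
  case (Act f)
  show ?case by (rule exI[of _ 1]) simp
next
  case (Seq c d)
  then obtain p p' where "\<forall>n. cost (poly q n) c = poly p n" "\<forall>n. cost (poly q n) d = poly p' n"
    by blast
  then show ?case by (intro exI[of _ "p + p' + 1"]) simp
next
  case (If b c d)
  then obtain p p' where "\<forall>n. cost (poly q n) c = poly p n" "\<forall>n. cost (poly q n) d = poly p' n"
    by blast
  then show ?case by (intro exI[of _ "p + p' + 1"]) simp
next
  case (While b c)
  then obtain p where "\<forall>n. cost (poly q n) c = poly p n" by blast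
  then show ?case by (intro exI[of _ "q * (p + [:2:]) + 1"]) simp
qed

lemma wp_mono:
  assumes "wp L c Q ts" "\<And>ts. Q ts \<Longrightarrow> Q' ts"
  shows "wp L c Q' ts"
  using assms
proof (induction c arbitrary: Q Q' ts)
  case (Seq c d)
  show ?case using Seq.prems(1) by (auto intro: Seq.IH Seq.prems(2))
next
  case (If b c d)
  show ?case using If.prems(1) by (auto intro: If.IH If.prems(2) split: if_splits)
next
  case (While b c)
  have "((\<lambda>R ts. if b (tops ts) then wp L c R ts else Q ts) ^^ n) (\<lambda>_. False) ts \<Longrightarrow>
    ((\<lambda>R ts. if b (tops ts) then wp L c R ts else Q' ts) ^^ n) (\<lambda>_. False) ts" for n ts
  proof (induction n arbitrary: ts)
    case (Suc n)
    show ?case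
    proof (cases "b (tops ts)")
      case True
      then show ?thesis using Suc.prems While.IH[OF _ Suc.IH] by simp
    next
      case False
      then show ?thesis using Suc.prems While.prems(2) by simp
    qed
  qed simp
  then show ?case using While.prems(1) by (simp only: wp.simps)
qed auto

text \<open>The variant is a list that loses one entry per iteration, so the invariant can name the
  data still to be processed while the length bounds the iterations. Pure counters are lists of
  units. The \<open>Suc L\<close> unfoldings in \<open>wp\<close> pay for \<open>L\<close>
  iterations and the final failing test.\<close>

lemma wp_While:
  assumes step: "\<And>x xs ts. I (x # xs) ts \<Longrightarrow> b (tops ts) \<and> wp L c (I xs) ts"
    and stop: "\<And>ts. I [] ts \<Longrightarrow> \<not> b (tops ts) \<and> Q ts"
    and init: "I xs ts" and len: "length xs \<le> L"
  shows "wp L (While b c) Q ts"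
proof -
  have "((\<lambda>R ts. if b (tops ts) then wp L c R ts else Q ts) ^^ Suc n) (\<lambda>_. False) ts"
    if "I xs ts" "length xs \<le> n" for n xs ts
    using that
  proof (induction n arbitrary: xs ts)
    case 0
    then show ?case using stop by auto
  next
    case (Suc n)
    show ?case
    proof (cases xs)
      case Nil
      then show ?thesis using stop Suc.prems by auto
    next
      case (Cons y ys)
      then have "b (tops ts)" "wp L c (I ys) ts" using step Suc.prems by auto
      moreover have "wp L c (((\<lambda>R ts. if b (tops ts) then wp L c R ts else Q ts) ^^ Suc n)
          (\<lambda>_. False)) ts"
        using \<open>wp L c (I ys) ts\<close>
        by (rule wp_mono) (use Suc Cons in auto)
      ultimately show ?thesis by (subst funpow.simps(2)) (simp del: funpow.simps)
    qed
  qed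
  then show ?thesis using init len by (simp only: wp.simps)
qed

declare wp.simps(5) [simp del]

text \<open>The time is only bounded by \<open>t\<close>: a run of \<open>c\<close> may idle in the
  fixpoint \<open>Skip\<close> of \<open>cmd_step\<close>, whereas \<open>Skip ;; d\<close> would
  already move on to \<open>d\<close>.\<close>

lemma cmd_steps_Seq:
  assumes "(cmd_step ^^ t) (c, ts) = (Skip, ts')"
  shows "\<exists>t' \<le> t. (cmd_step ^^ t') (c ;; d, ts) = (Skip ;; d, ts')"
  using assms
proof (induction t arbitrary: c ts)
  case 0
  then show ?case by auto
next
  case (Suc t)
  show ?case
  proof (cases "c = Skip")
    case True
    have "(cmd_step ^^ n) (Skip, ts) = (Skip, ts)" for n by (induction n) auto
    then show ?thesis using True Suc.prems by (intro exI[of _ 0]) (simp del: funpow.simps)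
  next
    case False
    obtain c1 ts1 where 1: "cmd_step (c, ts) = (c1, ts1)" by force
    then have "(cmd_step ^^ t) (c1, ts1) = (Skip, ts')"
      using Suc.prems by (simp add: funpow_Suc_right del: funpow.simps cmd_step.simps)
    then obtain t' where t': "t' \<le> t" "(cmd_step ^^ t') (c1 ;; d, ts1) = (Skip ;; d, ts')"
      using Suc.IH by blast
    have "cmd_step (c ;; d, ts) = (c1 ;; d, ts1)" using 1 False by auto
    then have "(cmd_step ^^ Suc t') (c ;; d, ts) = (Skip ;; d, ts')"
      using t' by (simp add: funpow_Suc_right del: funpow.simps cmd_step.simps)
    then show ?thesis using t'(1) by (meson Suc_le_mono)
  qed
qed

lemma cmd_steps_trans:
  "(cmd_step ^^ t) x = y \<Longrightarrow> (cmd_step ^^ t') y = z \<Longrightarrow> (cmd_step ^^ (t' + t)) x = z"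
  by (simp add: funpow_add)

lemma wp_sound:
  "wp L c Q ts \<Longrightarrow> \<exists>t \<le> cost L c. \<exists>ts'. (cmd_step ^^ t) (c, ts) = (Skip, ts') \<and> Q ts'"
proof (induction c arbitrary: Q ts)
  case Skip
  then show ?case by (intro exI[of _ 0]) auto
next
  case (Act f)
  then show ?case by (intro exI[of _ 1]) auto
next
  case (Seq c d)
  then obtain t1 ts1 where 1: "t1 \<le> cost L c" "(cmd_step ^^ t1) (c, ts) = (Skip, ts1)"
      "wp L d Q ts1"
    by (metis wp.simps(3))
  then obtain t2 ts2 where 2: "t2 \<le> cost L d" "(cmd_step ^^ t2) (d, ts1) = (Skip, ts2)" "Q ts2"
    using Seq.IH(2) by metis
  obtain t' where t': "t' \<le> t1" "(cmd_step ^^ t') (c ;; d, ts) = (Skip ;; d, ts1)"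
    using cmd_steps_Seq 1(2) by metis
  have "(cmd_step ^^ 1) (Skip ;; d, ts1) = (d, ts1)" by simp
  then have "(cmd_step ^^ (t2 + (1 + t'))) (c ;; d, ts) = (Skip, ts2)"
    by (rule cmd_steps_trans[OF cmd_steps_trans[OF t'(2)] 2(2)])
  moreover have "t2 + (1 + t') \<le> cost L (c ;; d)" using 1(1) 2(1) t'(1) by simp
  ultimately show ?case using 2(3) by blast
next
  case (If b c d)
  define e where "e = (if b (tops ts) then c else d)"
  have "wp L e Q ts" using If.prems by (auto simp: e_def split: if_splits)
  then obtain t ts' where t: "t \<le> cost L c + cost L d" "(cmd_step ^^ t) (e, ts) = (Skip, ts')"
      "Q ts'"
  proof (cases "b (tops ts)")
    case True
    then show ?thesis using If.IH(1)[of Q ts] \<open>wp L e Q ts\<close> that unfolding e_def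
      by (auto intro: trans_le_add1)
  next
    case False
    then show ?thesis using If.IH(2)[of Q ts] \<open>wp L e Q ts\<close> that unfolding e_def
      by (auto intro: trans_le_add2)
  qed
  have "(cmd_step ^^ 1) (If b c d, ts) = (e, ts)" by (simp add: e_def)
  then have "(cmd_step ^^ (t + 1)) (If b c d, ts) = (Skip, ts')"
    by (rule cmd_steps_trans[OF _ t(2)])
  then show ?case using t by (intro exI[of _ "t + 1"]) auto
next
  case (While b c)
  let ?F = "\<lambda>R ts. if b (tops ts) then wp L c R ts else Q ts"
  have "(?F ^^ Suc n) (\<lambda>_. False) ts \<Longrightarrow>
    \<exists>t \<le> n * (cost L c + 2) + 1. \<exists>ts'. (cmd_step ^^ t) (While b c, ts) = (Skip, ts') \<and> Q ts'"
    for n ts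
  proof (induction n arbitrary: ts)
    case 0
    \<comment> \<open>With a single unfolding left, entering the body would require it to terminate
      in a state satisfying \<open>False\<close>. So the guard fails here.\<close>
    have False if "wp L c (\<lambda>_. False) ts" using While.IH[OF that] by blast
    then have "\<not> b (tops ts)" "Q ts" using 0 by (auto split: if_splits)
    then show ?case by (intro exI[of _ 1]) auto
  next
    case (Suc n)
    show ?case
    proof (cases "b (tops ts)")
      case False
      then have "Q ts" using Suc.prems by (subst (asm) funpow.simps(2)) (simp del: funpow.simps)
      then show ?thesis using False by (intro exI[of _ 1]) auto
    next
      case True
      then have "wp L c ((?F ^^ Suc n) (\<lambda>_. False)) ts"
        using Suc.prems by (subst (asm) funpow.simps(2)) (simp del: funpow.simps)
      then obtain t1 ts1 where 1: "t1 \<le> cost L c" "(cmd_step ^^ t1) (c, ts) = (Skip, ts1)"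
          "(?F ^^ Suc n) (\<lambda>_. False) ts1"
        using While.IH[OF \<open>wp L c _ ts\<close>] by blast
      obtain t2 ts2 where 2: "t2 \<le> n * (cost L c + 2) + 1"
          "(cmd_step ^^ t2) (While b c, ts1) = (Skip, ts2)" "Q ts2"
        using Suc.IH[OF 1(3)] by blast
      obtain t' where t': "t' \<le> t1"
          "(cmd_step ^^ t') (c ;; While b c, ts) = (Skip ;; While b c, ts1)"
        using cmd_steps_Seq 1(2) by metis
      have "(cmd_step ^^ 1) (While b c, ts) = (c ;; While b c, ts)"
        "(cmd_step ^^ 1) (Skip ;; While b c, ts1) = (While b c, ts1)" using True by simp_all
      then have "(cmd_step ^^ (t2 + (1 + (t' + 1)))) (While b c, ts) = (Skip, ts2)"
        by (rule cmd_steps_trans[OF cmd_steps_trans[OF cmd_steps_trans[OF _ t'(2)]] 2(2)])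
      moreover have "t2 + (1 + (t' + 1)) \<le> Suc n * (cost L c + 2) + 1"
        using 1(1) 2(1) t'(1) by simp
      ultimately show ?thesis using 2(3) by blast
    qed
  qed
  then show ?case using While.prems by (simp only: wp.simps cost.simps)
qed

subsection \<open>Compilation to a Turing machine\<close>

text \<open>The analogue of the partial derivatives of a regular expression: a finite set containing
  \<open>c\<close> and closed under \<open>next_cmd\<close>. It stays finite because a body returns
  to the same \<open>While b c\<close> and not to ever longer unfoldings.\<close>

primrec residuals :: "'r cmd \<Rightarrow> 'r cmd set" where
  "residuals Skip = {Skip}"
| "residuals (Act f) = {Act f, Skip}"
| "residuals (c ;; d) = (\<lambda>c'. c' ;; d) ` residuals c \<union> residuals d"
| "residuals (If b c d) = {If b c d} \<union> residuals c \<union> residuals d"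
| "residuals (While b c) = {While b c, Skip} \<union> (\<lambda>c'. c' ;; While b c) ` residuals c"

primrec wf_cmd :: "'r cmd \<Rightarrow> bool" where
  "wf_cmd Skip = True"
| "wf_cmd (Act f) = (\<forall>r s. (\<forall>s. r s < 6) \<longrightarrow> fst (f r s) < 6)"
| "wf_cmd (c ;; d) = (wf_cmd c \<and> wf_cmd d)"
| "wf_cmd (If b c d) = (wf_cmd c \<and> wf_cmd d)"
| "wf_cmd (While b c) = wf_cmd c"

lemma finite_residuals: "finite (residuals c)"
  by (induction c) auto

lemma residuals_self: "c \<in> residuals c"
  by (induction c) auto

lemma residuals_next: "d \<in> residuals c \<Longrightarrow> fst (next_cmd d r) \<in> residuals c"
proof (induction c arbitrary: d)
  case (Seq c1 c2)
  then show ?case by (auto simp: residuals_self)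
next
  case (While b c)
  then show ?case by (auto simp: residuals_self split: if_splits)
next
  case (If b c1 c2)
  then show ?case by (auto simp: residuals_self)
qed auto

lemma residuals_wf:
  assumes "wf_cmd c" "d \<in> residuals c"
  shows "wf_cmd d"
proof -
  have "\<forall>d \<in> residuals c. wf_cmd d" using assms(1)
  proof (induction c)
    case (Act f)
    then show ?case using wf_cmd.simps(1) unfolding residuals.simps by blast
  next
    case (Seq c d)
    from Seq.prems have "wf_cmd c" "wf_cmd d" by simp_all
    with Seq.IH have "\<forall>d \<in> residuals c. wf_cmd d" "\<forall>e \<in> residuals d. wf_cmd e" by blast+
    with \<open>wf_cmd d\<close> show ?case by auto
  next
    case (If b c d)
    from If.prems have "wf_cmd c" "wf_cmd d" by simp_all
    with If.IH have "\<forall>d \<in> residuals c. wf_cmd d" "\<forall>e \<in> residuals d. wf_cmd e" by blast+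
    with \<open>wf_cmd c\<close> \<open>wf_cmd d\<close> show ?case by auto
  next
    case (While b c)
    from While.prems have "wf_cmd c" by simp
    with While.IH have "\<forall>d \<in> residuals c. wf_cmd d" by blast
    with \<open>wf_cmd c\<close> show ?case by auto
  qed simp
  then show ?thesis using assms(2) by blast
qed

lemma next_cmd_wf: "wf_cmd c \<Longrightarrow> \<forall>s. r s < 6 \<Longrightarrow> fst (snd (next_cmd c r) s) < 6"
proof (induction c)
  case (Act f)
  then show ?case by (metis next_cmd.simps(2) snd_conv wf_cmd.simps(2))
qed (simp_all add: keep_def)

text \<open>States number the residuals of \<open>c\<close>. The machine model forces
  \<open>c\<close> to be state \<open>0\<close> and \<open>Skip\<close> to be the last state, so the
  two must differ. Tape number j belongs to the j-th entry of \<open>rs\<close>, and the result is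
  read from the last one.\<close>

lemma compile:
  fixes c :: "'r cmd"
  assumes rs: "distinct rs" "set rs = UNIV" and "wf_cmd c" "c \<noteq> Skip"
  obtains M where "wf_tm M" "tapes M = length rs"
    "\<And>L P ts w. wp L c (\<lambda>ts. \<exists>v. P v \<and> snd (ts (last rs)) = word_tape v) ts \<Longrightarrow>
      init_config M w = (0, map ts rs) \<Longrightarrow> \<exists>v. P v \<and> computes_within M (cost L c) w v"
proof -
  obtain k and h :: "'r cmd \<Rightarrow> nat" where h: "bij_betw h (residuals c - {c, Skip}) {..<k}"
    using ex_bij_betw_finite_nat[of "residuals c - {c, Skip}"] finite_residuals
    by (metis atLeast0LessThan finite_Diff)
  define enc where "enc d = (if d = c then 0 else if d = Skip then Suc k else Suc (h d))" for d
  define dec where "dec = inv_into (residuals c) enc"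
  have h_less: "h d < k" if "d \<in> residuals c" "d \<noteq> c" "d \<noteq> Skip" for d
    using h that by (auto simp: bij_betw_def)
  have h_eq: "d = e" if "h d = h e" "d \<in> residuals c" "d \<noteq> c" "d \<noteq> Skip"
    "e \<in> residuals c" "e \<noteq> c" "e \<noteq> Skip" for d e
    by (rule inj_onD[OF bij_betw_imp_inj_on[OF h]]) (use that in auto)
  have inj: "inj_on enc (residuals c)"
  proof (rule inj_onI)
    fix d e
    assume "d \<in> residuals c" "e \<in> residuals c" "enc d = enc e"
    then show "d = e"
      using h_less[of d] h_less[of e] h_eq[of d e] by (auto simp: enc_def split: if_splits)
  qed
  have enc_le: "enc d \<le> Suc k" if "d \<in> residuals c" for d
    using h_less[OF that] by (auto simp: enc_def)
  have surj: "q \<in> enc ` residuals c" if "q < Suc k" for q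
  proof (cases q)
    case 0
    then show ?thesis using residuals_self[of c] by (force simp: enc_def image_iff)
  next
    case (Suc j)
    then have "j \<in> h ` (residuals c - {c, Skip})" using h that by (auto simp: bij_betw_def)
    then obtain d where "d \<in> residuals c - {c, Skip}" "j = h d" by blast
    then show ?thesis unfolding Suc by (intro image_eqI[of _ _ d]) (auto simp: enc_def)
  qed
  have dec_enc: "dec (enc d) = d" if "d \<in> residuals c" for d
    unfolding dec_def using inj that by simp
  have dec_in: "dec q \<in> residuals c" if "q < Suc k" for q
    unfolding dec_def using surj that by (intro inv_into_into)
  \<comment> \<open>Turns the list of scanned symbols, which is what \<open>delta\<close> receives,
    back into a function on registers.\<close>
  define look where "look ss = (\<lambda>s :: 'r. the (map_of (zip rs ss) s))" for ss :: "nat list"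
  define M where "M = \<lparr>tapes = length rs, states = Suc k, symbols = 6,
    delta = (\<lambda>q ss. (enc (fst (next_cmd (dec q) (look ss))),
      map (snd (next_cmd (dec q) (look ss))) rs))\<rparr>"
  have look_map: "look (map f rs) = f" for f
    by (rule ext) (simp add: look_def zip_map2 zip_same_conv_map map_of_map_restrict
        rs comp_def restrict_map_def)
  have look_less: "look ss s < 6" if "length ss = length rs" "set ss \<subseteq> {..<6}" for ss s
  proof -
    have "s \<in> fst ` set (zip rs ss)" using rs(2) that(1) by (metis UNIV_I map_fst_zip set_map)
    then obtain x where x: "map_of (zip rs ss) s = Some x"
      by (metis map_of_eq_None_iff not_None_eq)
    then have "x \<in> set ss" by (metis map_of_SomeD set_zip_rightD)
    then show ?thesis using that(2) x by (auto simp: look_def)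
  qed
  have "wf_tm M"
    unfolding wf_tm_def
  proof (intro conjI allI impI)
    show "1 \<le> tapes M" using rs(2) by (cases rs) (auto simp: M_def)
    show "6 \<le> symbols M" by (simp add: M_def)
    fix q ss
    assume q: "q < states M" and ss: "length ss = tapes M \<and> set ss \<subseteq> {..<symbols M}"
    then have dec: "dec q \<in> residuals c" using dec_in by (simp add: M_def)
    then show "fst (delta M q ss) \<le> states M"
      by (simp add: M_def enc_le residuals_next)
    show "length (snd (delta M q ss)) = tapes M" by (simp add: M_def)
    show "fst ` set (snd (delta M q ss)) \<subseteq> {..<symbols M}"
      using next_cmd_wf[OF residuals_wf[OF assms(3) dec]] look_less ss by (auto simp: M_def)
  qed
  moreover have step: "tm_step M (enc d, map ts rs) = (enc d', map ts' rs)"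
    if "cmd_step (d, ts) = (d', ts')" "d \<in> residuals c" for d d' ts ts'
  proof (cases "d = Skip")
    case True
    then show ?thesis using that assms(4) by (auto simp: enc_def M_def)
  next
    case False
    then have "enc d < Suc k" using that h_less by (auto simp: enc_def)
    moreover have "map (\<lambda>(h, t). t h) (map ts rs) = map (tops ts) rs"
      by (auto simp: tops_def split: prod.split)
    moreover have "map2 act (map f rs) (map ts rs) = map (apply_act f ts) rs" for f
      by (simp add: zip_map_map zip_same_conv_map comp_def apply_act_def)
    ultimately show ?thesis using that(1)
      by (auto simp: M_def dec_enc[OF that(2)] look_map simp del: map_map)
  qed
  have steps: "(tm_step M ^^ t) (enc d, map ts rs) = (enc d', map ts' rs)"
    if "(cmd_step ^^ t) (d, ts) = (d', ts')" "d \<in> residuals c" for t d d' ts ts'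
    using that
  proof (induction t arbitrary: d ts)
    case (Suc t)
    obtain d1 ts1 where 1: "cmd_step (d, ts) = (d1, ts1)" by force
    moreover have "d1 \<in> residuals c" using 1 residuals_next[OF Suc.prems(2)] by auto
    ultimately show ?case using Suc step[OF 1]
      by (simp add: funpow_Suc_right del: funpow.simps cmd_step.simps tm_step.simps)
  qed simp
  have "\<exists>v. P v \<and> computes_within M (cost L c) w v"
    if prem: "wp L c (\<lambda>ts. \<exists>v. P v \<and> snd (ts (last rs)) = word_tape v) ts"
      "init_config M w = (0, map ts rs)" for L P ts w
  proof -
    obtain t ts' v where t: "t \<le> cost L c" "(cmd_step ^^ t) (c, ts) = (Skip, ts')" "P v"
        "snd (ts' (last rs)) = word_tape v"
      using wp_sound[OF prem(1)] by blast
    have "(tm_step M ^^ t) (init_config M w) = (states M, map ts' rs)"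
      using steps[OF t(2) residuals_self] prem(2) assms(4) by (simp add: enc_def M_def)
    moreover have "snd (last (map ts' rs)) = word_tape v"
      using t(4) rs(2) by (subst last_map) auto
    ultimately show ?thesis using t(1,3) unfolding computes_within_def by blast
  qed
  ultimately show thesis using that[of M] by (simp add: M_def)
qed

section \<open>Stack programs\<close>

text \<open>The head is on the topmost symbol, hence at position \<open>-1\<close> if the stack is empty.\<close>

definition stk :: "('r \<Rightarrow> word) \<Rightarrow> 'r \<Rightarrow> tape" where
  "stk \<sigma> s = (int (length (\<sigma> s)) - 1, word_tape (rev (\<sigma> s)))"

text \<open>The default \<open>0\<close> is the blank found at position \<open>-1\<close>. Comparing
  with \<open>0\<close> thus tests for emptiness, provided that only nonzero symbols are
  stored.\<close>

fun peek :: "word \<Rightarrow> nat" where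
  "peek [] = 0"
| "peek (x # xs) = x"

text \<open>Two actions are needed since \<open>act\<close> writes before it moves. The value is
  computed after the move, when the head of \<open>t\<close> scans a blank; this is the
  \<open>t := 0\<close> in \<open>wp_push\<close>.\<close>

definition push :: "'r \<Rightarrow> (('r \<Rightarrow> nat) \<Rightarrow> nat) \<Rightarrow> 'r cmd" where
  "push t g = Act (\<lambda>r s. (r s, if s = t then Right else Stay)) ;;
    Act (\<lambda>r s. (if s = t then g r else r s, Stay))"

definition pop :: "'r \<Rightarrow> 'r cmd" where
  "pop t = Act (\<lambda>r s. if s = t then (0, Left) else (r s, Stay))"

definition replace :: "'r \<Rightarrow> (('r \<Rightarrow> nat) \<Rightarrow> nat) \<Rightarrow> 'r cmd" where
  "replace t g = Act (\<lambda>r s. (if s = t then g r else r s, Stay))"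

definition pour :: "(nat \<Rightarrow> bool) \<Rightarrow> 'r \<Rightarrow> 'r \<Rightarrow> 'r cmd" where
  "pour P s t = While (\<lambda>r. P (r s)) (push t (\<lambda>r. r s) ;; pop s)"

definition drop_while :: "(nat \<Rightarrow> bool) \<Rightarrow> 'r \<Rightarrow> 'r cmd" where
  "drop_while P s = While (\<lambda>r. P (r s)) (pop s)"

lemma wf_push [simp]: "(\<And>r. \<forall>s. r s < 6 \<Longrightarrow> g r < 6) \<Longrightarrow> wf_cmd (push t g)"
  and wf_pop [simp]: "wf_cmd (pop t)"
  and wf_replace [simp]: "(\<And>r. \<forall>s. r s < 6 \<Longrightarrow> g r < 6) \<Longrightarrow> wf_cmd (replace t g)"
  by (simp_all add: push_def pop_def replace_def)

lemma wf_pour [simp]: "wf_cmd (pour P s t)"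
  and wf_drop_while [simp]: "wf_cmd (drop_while P s)"
  by (simp_all add: pour_def drop_while_def)

lemma word_tape_snoc: "word_tape (xs @ [x]) = (word_tape xs)(int (length xs) := x)"
  by (rule ext) (auto simp: word_tape_def nth_append)

lemma word_tape_peek [simp]:
  "word_tape (rev xs) (int (length xs) - 1) = peek xs"
  "(word_tape (rev xs))(int (length xs) - 1 := peek xs) = word_tape (rev xs)"
  "word_tape (rev xs) (int (length xs)) = 0"
proof -
  show *: "word_tape (rev xs) (int (length xs) - 1) = peek xs"
    by (cases xs) (auto simp: word_tape_snoc word_tape_def)
  show "(word_tape (rev xs))(int (length xs) - 1 := peek xs) = word_tape (rev xs)"
    by (rule fun_upd_idem) (rule *)
  show "word_tape (rev xs) (int (length xs)) = 0" by (simp add: word_tape_def)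
qed

lemma tops_stk [simp]: "tops (stk \<sigma>) = (\<lambda>s. peek (\<sigma> s))"
  by (rule ext) (simp add: tops_def stk_def)

lemma apply_push_aux:
  "apply_act (\<lambda>s. (peek (\<sigma> s), if s = t then Right else Stay)) (stk \<sigma>) =
    (stk \<sigma>)(t := (int (length (\<sigma> t)), word_tape (rev (\<sigma> t))))"
  by (rule ext) (simp add: apply_act_def stk_def)

lemma wp_push [simp]:
  "wp L (push t g) Q (stk \<sigma>) =
    Q (stk (\<sigma>(t := g ((\<lambda>s. peek (\<sigma> s))(t := 0)) # \<sigma> t)))"
proof -
  let ?ts = "(stk \<sigma>)(t := (int (length (\<sigma> t)), word_tape (rev (\<sigma> t))))"
  have r: "tops ?ts = (\<lambda>s. peek (\<sigma> s))(t := 0)"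
    by (rule ext) (auto simp: tops_def stk_def)
  have "apply_act (\<lambda>s. (if s = t then a else ((\<lambda>s. peek (\<sigma> s))(t := 0)) s, Stay)) ?ts =
      stk (\<sigma>(t := a # \<sigma> t))" for a
    by (rule ext) (auto simp: apply_act_def tops_def stk_def word_tape_snoc)
  then show ?thesis by (simp add: push_def apply_push_aux r del: fun_upd_apply cong: if_cong)
qed

text \<open>On an empty stack the head would go to \<open>-2\<close>, which represents no stack;
  hence the assumption.\<close>

lemma wp_pop [simp]:
  assumes "\<sigma> t \<noteq> []"
  shows "wp L (pop t) Q (stk \<sigma>) = Q (stk (\<sigma>(t := tl (\<sigma> t))))"
proof -
  obtain x xs where x: "\<sigma> t = x # xs" using assms by (cases "\<sigma> t") auto
  have "apply_act (\<lambda>s. if s = t then (0, Left) else (peek (\<sigma> s), Stay)) (stk \<sigma>) =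
      stk (\<sigma>(t := tl (\<sigma> t)))"
  proof -
    have "(word_tape (rev xs))(int (length xs) := 0) = word_tape (rev xs)"
      by (rule ext) (auto simp: word_tape_def)
    then show ?thesis
      by (intro ext) (auto simp: apply_act_def tops_def stk_def word_tape_snoc x)
  qed
  then show ?thesis by (simp add: pop_def cong: if_cong)
qed

lemma wp_replace [simp]:
  assumes "\<sigma> t \<noteq> []"
  shows "wp L (replace t g) Q (stk \<sigma>) = Q (stk (\<sigma>(t := g (\<lambda>s. peek (\<sigma> s)) # tl (\<sigma> t))))"
proof -
  obtain x xs where x: "\<sigma> t = x # xs" using assms by (cases "\<sigma> t") auto
  have "apply_act (\<lambda>s. (if s = t then a else peek (\<sigma> s), Stay)) (stk \<sigma>) =
      stk (\<sigma>(t := a # tl (\<sigma> t)))" for a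
    by (rule ext) (auto simp: apply_act_def tops_def stk_def word_tape_snoc x)
  then show ?thesis by (simp add: replace_def cong: if_cong)
qed

lemma wp_pour:
  assumes "s \<noteq> t" "\<sigma> s = xs @ ys" "\<forall>x \<in> set xs. P x" "\<not> P (peek ys)" "length xs \<le> L"
    and Q: "Q (stk (\<sigma>(s := ys, t := rev xs @ \<sigma> t)))"
  shows "wp L (pour P s t) Q (stk \<sigma>)"
  unfolding pour_def
proof (rule wp_While[where I = "\<lambda>zs ts. \<exists>us. xs = us @ zs \<and>
      ts = stk (\<sigma>(s := zs @ ys, t := rev us @ \<sigma> t))"])
  fix z zs ts
  assume "\<exists>us. xs = us @ z # zs \<and> ts = stk (\<sigma>(s := (z # zs) @ ys, t := rev us @ \<sigma> t))"
  then obtain us where us: "xs = us @ z # zs"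
      "ts = stk (\<sigma>(s := (z # zs) @ ys, t := rev us @ \<sigma> t))" by blast
  have "\<sigma>(s := z # zs @ ys, t := z # rev us @ \<sigma> t, s := zs @ ys) =
      \<sigma>(s := zs @ ys, t := rev (us @ [z]) @ \<sigma> t)" using assms(1) by auto
  then show "P (tops ts s) \<and> wp L (push t (\<lambda>r. r s) ;; pop s)
      (\<lambda>ts. \<exists>us. xs = us @ zs \<and> ts = stk (\<sigma>(s := zs @ ys, t := rev us @ \<sigma> t))) ts"
    using us assms(1,3) by (auto intro!: exI[of _ "us @ [z]"])
qed (use assms in \<open>auto simp: fun_upd_idem\<close>)

lemma wp_drop_while:
  assumes "\<sigma> s = xs @ ys" "\<forall>x \<in> set xs. P x" "\<not> P (peek ys)" "length xs \<le> L"
    and Q: "Q (stk (\<sigma>(s := ys)))"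
  shows "wp L (drop_while P s) Q (stk \<sigma>)"
  unfolding drop_while_def
proof (rule wp_While[where I = "\<lambda>zs ts. set zs \<subseteq> set xs \<and> ts = stk (\<sigma>(s := zs @ ys))"])
qed (use assms in \<open>auto simp: fun_upd_idem\<close>)

section \<open>Arithmetic on stacks\<close>

text \<open>The symbols \<open>1\<close> and \<open>2\<close> are the binary digits, and the least significant one is on top.\<close>

fun val :: "word \<Rightarrow> nat" where
  "val [] = 0"
| "val (x # xs) = (x - 1) + 2 * val xs"

abbreviation digits :: "word \<Rightarrow> bool" where
  "digits xs \<equiv> set xs \<subseteq> {1, 2}"

lemma val_append: "val (xs @ ys) = val xs + 2 ^ length xs * val ys"
  by (induction xs) (simp_all add: algebra_simps)

text \<open>\<open>AddZ\<close>, \<open>AddY\<close>, \<open>Carry\<close> and \<open>MulP\<close>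
  are scratch stacks that are empty between operations. \<open>MulP\<close> is shared by
  \<open>mac\<close>, \<open>move\<close> and \<open>put\<close>.\<close>

datatype reg = Input | Scan | Unary | UnaryTemp | Counts | CountsTemp | Row | Numer | Denom |
  Count | Scaled | SumN | SumD | NewN | NewD | AddZ | AddY | Carry | MulP | Output

section \<open>Ripple-carry addition\<close>

definition digit_sum :: "nat \<Rightarrow> nat \<Rightarrow> nat \<Rightarrow> nat" where
  "digit_sum a b c = (a - 1) + (b - 1) + (c - 1)"

definition carry :: "nat \<Rightarrow> nat" where
  "carry t = (if t < 2 then 1 else 2)"

definition add :: "reg \<Rightarrow> reg \<Rightarrow> reg cmd" where
  "add x y =
    push Carry (\<lambda>_. 1) ;;
    While (\<lambda>r. r x \<noteq> 0 \<or> r y \<noteq> 0) (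
      push AddZ (\<lambda>r. digit_sum (r x) (r y) (r Carry) mod 2 + 1) ;;
      replace Carry (\<lambda>r. carry (digit_sum (r x) (r y) (r Carry))) ;;
      If (\<lambda>r. r y \<noteq> 0) (push AddY (\<lambda>r. r y) ;; pop y) Skip ;;
      If (\<lambda>r. r x \<noteq> 0) (pop x) Skip) ;;
    push AddZ (\<lambda>r. r Carry) ;;
    pop Carry ;;
    pour (\<lambda>a. a \<noteq> 0) AddZ x ;;
    pour (\<lambda>a. a \<noteq> 0) AddY y"

lemma wf_add [simp]: "wf_cmd (add x y)"
  by (simp add: add_def carry_def)

lemma wp_add:
  fixes x y :: reg
  assumes xy: "x \<noteq> y" "x \<notin> {AddZ, AddY, Carry}" "y \<notin> {AddZ, AddY, Carry}"
    and temps: "\<sigma> AddZ = []" "\<sigma> AddY = []" "\<sigma> Carry = []"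
    and dig: "digits (\<sigma> x)" "digits (\<sigma> y)"
    and len: "length (\<sigma> x) < L" "length (\<sigma> y) < L"
    and Q: "\<And>zs. digits zs \<Longrightarrow> val zs = val (\<sigma> x) + val (\<sigma> y) \<Longrightarrow>
      length zs = max (length (\<sigma> x)) (length (\<sigma> y)) + 1 \<Longrightarrow> Q (stk (\<sigma>(x := zs)))"
  shows "wp L (add x y) Q (stk \<sigma>)"
proof -
  have neq: "x \<noteq> AddZ" "x \<noteq> AddY" "x \<noteq> Carry" "y \<noteq> AddZ" "y \<noteq> AddY" "y \<noteq> Carry" "y \<noteq> x"
    "AddZ \<noteq> x" "AddY \<noteq> x" "Carry \<noteq> x" "AddZ \<noteq> y" "AddY \<noteq> y" "Carry \<noteq> y"
    using xy by auto
  define n where "n = max (length (\<sigma> x)) (length (\<sigma> y))"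
  define st where "st xs ys c zs us = \<sigma>(x := xs, y := ys, Carry := [c], AddZ := zs, AddY := us)"
    for xs ys us zs :: word and c :: nat
  \<comment> \<open>The digits produced so far, plus the unread parts and the carry weighted by
    \<open>2 ^ length zs\<close>, always give the full sum. The list \<open>l\<close> only counts
    the positions left.\<close>
  define I where "I l ts \<longleftrightarrow> (\<exists>xs ys c zs us. ts = stk (st xs ys c zs us) \<and>
      length l = max (length xs) (length ys) \<and> length zs + length l = n \<and>
      \<sigma> y = rev us @ ys \<and> digits xs \<and> digits ys \<and> digits [c] \<and> digits zs \<and>
      val (rev zs) + 2 ^ length zs * (val xs + val ys + (c - 1)) = val (\<sigma> x) + val (\<sigma> y))"
    for l :: "unit list" and ts
  have I_stI: "I l (stk (st xs ys c zs us))"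
    if "length l = max (length xs) (length ys)" "length zs + length l = n"
      "\<sigma> y = rev us @ ys" "digits xs" "digits ys" "digits [c]" "digits zs"
      "val (rev zs) + 2 ^ length zs * (val xs + val ys + (c - 1)) = val (\<sigma> x) + val (\<sigma> y)"
    for l xs ys zs us c
    unfolding I_def using that by blast
  show ?thesis
    unfolding add_def wp.simps(3) wp_push
  proof (rule wp_While[where I = I and xs = "replicate n ()"])
    show "I (replicate n ()) (stk (\<sigma>(Carry := 1 # \<sigma> Carry)))"
    proof -
      have "\<sigma>(Carry := 1 # \<sigma> Carry) = st (\<sigma> x) (\<sigma> y) 1 [] []"
        using temps neq by (auto simp: st_def fun_eq_iff)
      then show ?thesis using I_stI[of _ "\<sigma> x" "\<sigma> y" "[]" "[]" 1] dig by (simp add: n_def)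
    qed
    show "length (replicate n ()) \<le> L" using len by (simp add: n_def)
  next
    fix ts
    assume "I [] ts"
    then obtain c zs us where *: "ts = stk (st [] [] c zs us)" "length zs = n"
      "\<sigma> y = rev us" "digits [c]" "digits zs"
      "val (rev zs) + 2 ^ length zs * (c - 1) = val (\<sigma> x) + val (\<sigma> y)"
      by (auto simp: I_def)
    have us: "us = rev (\<sigma> y)" using *(3) by simp
    have "Q (stk (\<sigma>(x := rev (c # zs))))"
      using * by (intro Q) (auto simp: val_append n_def)
    moreover have "(st [] [] c zs us)(AddZ := c # zs, Carry := [], AddZ := [], x := rev (c # zs),
        AddY := [], y := \<sigma> y) = \<sigma>(x := rev (c # zs))"
      using neq temps by (auto simp: fun_eq_iff st_def)
    ultimately have Q1: "Q (stk ((st [] [] c zs us)(AddZ := c # zs, Carry := [], AddZ := [],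
        x := rev (c # zs), AddY := [], y := \<sigma> y)))"
      by simp
    have "wp L (pour (\<lambda>a. a \<noteq> 0) AddY y) Q
        (stk ((st [] [] c zs us)(AddZ := c # zs, Carry := [], AddZ := [], x := rev (c # zs))))"
      by (rule wp_pour[where xs = us and ys = "[]"])
        (use neq dig len Q1 in \<open>auto simp: st_def us\<close>)
    from this[simplified] have Q2: "wp L (pour (\<lambda>a. a \<noteq> 0) AddZ x) (wp L (pour (\<lambda>a. a \<noteq> 0) AddY y) Q)
        (stk ((st [] [] c zs us)(AddZ := c # zs, Carry := [])))"
      by - (rule wp_pour[where xs = "c # zs" and ys = "[]"],
        use neq * len in \<open>auto simp: st_def n_def\<close>)
    have "st [] [] c zs us Carry = [c]" "st [] [] c zs us AddZ = zs"
      "st [] [] c zs us x = []" "st [] [] c zs us y = []"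
      using neq by (auto simp: st_def)
    then show "\<not> (tops ts x \<noteq> 0 \<or> tops ts y \<noteq> 0) \<and>
      wp L (push AddZ (\<lambda>r. r Carry)) (wp L (pop Carry)
        (wp L (pour (\<lambda>a. a \<noteq> 0) AddZ x) (wp L (pour (\<lambda>a. a \<noteq> 0) AddY y) Q))) ts"
      using Q2 by (simp add: *(1))
  next
    fix u l ts
    assume "I (u # l) ts"
    then obtain xs ys c zs us where *: "ts = stk (st xs ys c zs us)"
      "Suc (length l) = max (length xs) (length ys)" "Suc (length zs + length l) = n"
      "\<sigma> y = rev us @ ys" "digits xs" "digits ys" "digits [c]" "digits zs"
      "val (rev zs) + 2 ^ length zs * (val xs + val ys + (c - 1)) = val (\<sigma> x) + val (\<sigma> y)"
      unfolding I_def by auto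
    define t where "t = digit_sum (peek xs) (peek ys) c"
    define c' where "c' = carry t"
    define us' where "us' = (if ys = [] then us else peek ys # us)"
    have peek: "peek w \<noteq> 0 \<longleftrightarrow> w \<noteq> []" "val w = (peek w - 1) + 2 * val (tl w)" "peek w - 1 \<le> 1"
      "digits (tl w)" if "digits w" for w
      using that by (cases w; force)+
    \<comment> \<open>Three digits add up to at most 3, and in that range \<open>carry t - 1\<close>
      is \<open>t div 2\<close>.\<close>
    have t: "t = t mod 2 + 2 * (c' - 1)"
      using peek(3)[OF *(5)] peek(3)[OF *(6)] *(7) unfolding t_def c'_def carry_def digit_sum_def
      by (auto simp: not_less le_Suc_eq)
    have "val xs + val ys + (c - 1) = t + 2 * (val (tl xs) + val (tl ys))"
      using peek(2)[OF *(5)] peek(2)[OF *(6)] unfolding t_def digit_sum_def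
      by (simp only: distrib_left ac_simps)
    also have "\<dots> = t mod 2 + 2 * (val (tl xs) + val (tl ys) + (c' - 1))"
      using arg_cong[OF t, of "\<lambda>z. z + 2 * (val (tl xs) + val (tl ys))"]
      by (simp only: distrib_left ac_simps)
    finally have "val (rev ((t mod 2 + 1) # zs)) +
        2 ^ length ((t mod 2 + 1) # zs) * (val (tl xs) + val (tl ys) + (c' - 1)) =
        val (\<sigma> x) + val (\<sigma> y)"
      unfolding *(9)[symmetric] by (simp add: val_append algebra_simps)
    moreover have "length l = max (length (tl xs)) (length (tl ys))" using *(2) by auto
    moreover have "\<sigma> y = rev us' @ tl ys" using *(4) by (cases ys) (auto simp: us'_def)
    moreover have "digits [c']" "digits ((t mod 2 + 1) # zs)" using *(8) by (auto simp: c'_def carry_def)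
    ultimately have I: "I l (stk (st (tl xs) (tl ys) c' ((t mod 2 + 1) # zs) us'))"
      using *(3) peek(4)[OF *(5)] peek(4)[OF *(6)] by (intro I_stI) simp_all
    \<comment> \<open>The case split at the end evaluates \<open>peek []\<close> to
      \<open>0\<close>; these equations fold \<open>t\<close> in the resulting terms.\<close>
    have t0: "xs = [] \<Longrightarrow> digit_sum 0 (peek ys) c = t" "ys = [] \<Longrightarrow> digit_sum (peek xs) 0 c = t"
      by (simp_all add: t_def)
    let ?s = "(st xs ys c zs us)(AddZ := (t mod 2 + 1) # zs, Carry := [c'])"
    have "(if ys \<noteq> [] then ?s(AddY := peek ys # us, y := tl ys) else ?s) =
        st xs (tl ys) c' ((t mod 2 + 1) # zs) us'"
      "(st xs (tl ys) c' ((t mod 2 + 1) # zs) us')(x := tl xs) =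
        st (tl xs) (tl ys) c' ((t mod 2 + 1) # zs) us'"
      using neq by (auto simp: st_def us'_def fun_eq_iff)
    moreover have "xs \<noteq> [] \<or> ys \<noteq> []" using *(2) by auto
    moreover have "st xs ys c zs us x = xs" "st xs ys c zs us y = ys" "st xs ys c zs us Carry = [c]"
      "st xs ys c zs us AddZ = zs" "st xs ys c zs us AddY = us" 
      "st xs (tl ys) c' ((t mod 2 + 1) # zs) us' x = xs"
      "st xs (tl ys) c' ((t mod 2 + 1) # zs) us' y = tl ys"
      using neq by (auto simp: st_def)
    ultimately show "(tops ts x \<noteq> 0 \<or> tops ts y \<noteq> 0) \<and> wp L (
      push AddZ (\<lambda>r. digit_sum (r x) (r y) (r Carry) mod 2 + 1) ;;
      replace Carry (\<lambda>r. carry (digit_sum (r x) (r y) (r Carry))) ;;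
      If (\<lambda>r. r y \<noteq> 0) (push AddY (\<lambda>r. r y) ;; pop y) Skip ;;
      If (\<lambda>r. r x \<noteq> 0) (pop x) Skip) (I l) ts"
      using I neq peek(1)[OF *(5)] peek(1)[OF *(6)]
      by (cases "xs = []"; cases "ys = []") (simp_all add: *(1) t0 flip: t_def c'_def)
  qed
qed

section \<open>Shift-and-add multiplication\<close>

definition mac :: "reg \<Rightarrow> reg \<Rightarrow> reg \<Rightarrow> reg cmd" where
  "mac p y z =
    While (\<lambda>r. r p \<noteq> 0) (
      If (\<lambda>r. r p = 2) (add z y) Skip ;;
      push y (\<lambda>_. 1) ;; push MulP (\<lambda>r. r p) ;; pop p) ;;
    While (\<lambda>r. r MulP \<noteq> 0) (push p (\<lambda>r. r MulP) ;; pop MulP ;; pop y)"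

lemma wf_mac [simp]: "wf_cmd (mac p y z)"
  by (simp add: mac_def)

text \<open>Pushing a digit 0 (symbol \<open>1\<close>) doubles \<open>y\<close>. The digits of
  \<open>p\<close> consumed go to \<open>MulP\<close>, and putting each of them back also undoes one
  shift. As \<open>M\<close> bounds both the initial \<open>z\<close> and every shifted
  \<open>y\<close> that is added, an iteration lengthens \<open>z\<close> beyond \<open>M\<close> by
  at most one digit, whence \<open>M + length (\<sigma> p)\<close>.\<close>

lemma wp_mac:
  fixes p y z :: reg
  assumes distinct: "p \<noteq> y" "p \<noteq> z" "y \<noteq> z" "{p, y, z} \<inter> {AddZ, AddY, Carry, MulP} = {}"
    and temps: "\<sigma> AddZ = []" "\<sigma> AddY = []" "\<sigma> Carry = []" "\<sigma> MulP = []"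
    and dig: "digits (\<sigma> p)" "digits (\<sigma> y)" "digits (\<sigma> z)"
    and M: "length (\<sigma> z) \<le> M" "length (\<sigma> p) + length (\<sigma> y) \<le> M"
    and L: "M + length (\<sigma> p) < L"
    and Q: "\<And>zs. digits zs \<Longrightarrow> val zs = val (\<sigma> z) + val (\<sigma> p) * val (\<sigma> y) \<Longrightarrow>
      length zs \<le> M + length (\<sigma> p) \<Longrightarrow> Q (stk (\<sigma>(z := zs)))"
  shows "wp L (mac p y z) Q (stk \<sigma>)"
proof -
  note neqs = distinct(1,2,3) distinct(4)[simplified]
  define st where "st ps us zs = \<sigma>(p := ps, MulP := us, y := replicate (length us) 1 @ \<sigma> y, z := zs)"
    for ps us zs :: word
  have st [simp]: "st ps us zs p = ps" "st ps us zs MulP = us"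
    "st ps us zs y = replicate (length us) 1 @ \<sigma> y" "st ps us zs z = zs"
    "st ps us zs AddZ = []" "st ps us zs AddY = []" "st ps us zs Carry = []" for ps us zs
    using neqs temps by (auto simp: st_def)
  define I where "I ps ts \<longleftrightarrow> (\<exists>us zs. ts = stk (st ps us zs) \<and> \<sigma> p = rev us @ ps \<and>
      digits zs \<and> length zs \<le> M + length us \<and>
      val zs + 2 ^ length us * val ps * val (\<sigma> y) = val (\<sigma> z) + val (\<sigma> p) * val (\<sigma> y))"
    for ps ts
  have val_shift: "val (replicate n 1 @ w) = 2 ^ n * val w" for n w
    by (induction n) auto
  show ?thesis
    unfolding mac_def wp.simps(3)
  proof (rule wp_While[where I = I and xs = "\<sigma> p"])
    have "\<sigma> = st (\<sigma> p) [] (\<sigma> z)" using neqs temps by (auto simp: st_def fun_eq_iff)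
    then have "stk \<sigma> = stk (st (\<sigma> p) [] (\<sigma> z))" by simp
    then show "I (\<sigma> p) (stk \<sigma>)"
      unfolding I_def using dig M by (intro exI[of _ "[]"] exI[of _ "\<sigma> z"]) simp
    show "length (\<sigma> p) \<le> L" using L by simp
  next
    fix ts
    assume "I [] ts"
    then obtain us zs where *: "ts = stk (st [] us zs)" "\<sigma> p = rev us" "digits zs"
        "length zs \<le> M + length (\<sigma> p)" "val zs = val (\<sigma> z) + val (\<sigma> p) * val (\<sigma> y)"
      by (auto simp: I_def)
    have Q': "Q (stk (\<sigma>(z := zs)))" using * by (intro Q) auto
    have "wp L (While (\<lambda>r. r MulP \<noteq> 0) (push p (\<lambda>r. r MulP) ;; pop MulP ;; pop y)) Q ts"
    proof (rule wp_While[where I = "\<lambda>vs ts. \<exists>ps. ts = stk (st ps vs zs) \<and> rev us = rev vs @ ps"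
          and xs = us])
      fix v vs ts
      assume "\<exists>ps. ts = stk (st ps (v # vs) zs) \<and> rev us = rev (v # vs) @ ps"
      then obtain ps where ps: "ts = stk (st ps (v # vs) zs)" "rev us = rev vs @ v # ps" by auto
      have "v \<in> set (rev us)" using ps(2) by simp
      then have "v \<noteq> 0" using *(2) dig(1) by auto
      moreover have "(st ps (v # vs) zs)(p := v # ps, MulP := vs,
          y := replicate (length vs) 1 @ \<sigma> y) = st (v # ps) vs zs"
        using neqs by (auto simp: st_def fun_eq_iff)
      ultimately show "tops ts MulP \<noteq> 0 \<and> wp L (push p (\<lambda>r. r MulP) ;; pop MulP ;; pop y)
          (\<lambda>ts. \<exists>ps. ts = stk (st ps vs zs) \<and> rev us = rev vs @ ps) ts"
        using ps neqs by (auto intro!: exI[of _ "v # ps"])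
    next
      fix ts
      assume "\<exists>ps. ts = stk (st ps [] zs) \<and> rev us = rev [] @ ps"
      then have ts: "ts = stk (st (rev us) [] zs)" by auto
      then have "tops ts MulP = 0" by simp
      moreover have "st (rev us) [] zs = \<sigma>(z := zs)"
        using neqs temps *(2) by (auto simp: st_def fun_eq_iff)
      ultimately show "\<not> tops ts MulP \<noteq> 0 \<and> Q ts" using Q' ts by simp
    next
      show "length us \<le> L" using arg_cong[OF *(2), of length] L by simp
    qed (use * in auto)
    then show "\<not> tops ts p \<noteq> 0 \<and>
      wp L (While (\<lambda>r. r MulP \<noteq> 0) (push p (\<lambda>r. r MulP) ;; pop MulP ;; pop y)) Q ts"
      by (simp add: *(1))
  next
    fix a ps ts
    assume "I (a # ps) ts"
    then obtain us zs where *: "ts = stk (st (a # ps) us zs)" "\<sigma> p = rev us @ a # ps"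
        "digits zs" "length zs \<le> M + length us"
        "val zs + 2 ^ length us * val (a # ps) * val (\<sigma> y) = val (\<sigma> z) + val (\<sigma> p) * val (\<sigma> y)"
      by (auto simp: I_def)
    have a: "a = 1 \<or> a = 2" using *(2) dig(1) by auto
    have len: "length us + length ps < length (\<sigma> p)" using *(2) by simp
    \<comment> \<open>Treats both digits at once: with \<open>a = 1\<close> the added term is 0 and
      \<open>zs'\<close> is \<open>zs\<close>, with \<open>a = 2\<close> it is the shifted
      \<open>y\<close>.\<close>
    have step: "wp L (push y (\<lambda>_. 1) ;; push MulP (\<lambda>r. r p) ;; pop p) (I ps)
        (stk (st (a # ps) us zs'))"
      if "digits zs'" "length zs' \<le> Suc (M + length us)"
        "val zs' = val zs + (a - 1) * 2 ^ length us * val (\<sigma> y)" for zs'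
    proof -
      have "(st (a # ps) us zs')(y := 1 # replicate (length us) 1 @ \<sigma> y, MulP := a # us, p := ps) =
          st ps (a # us) zs'"
        using neqs by (auto simp: st_def fun_eq_iff)
      moreover have "I ps (stk (st ps (a # us) zs'))"
        unfolding I_def
      proof (intro exI conjI)
        show "stk (st ps (a # us) zs') = stk (st ps (a # us) zs')" ..
        show "val zs' + 2 ^ length (a # us) * val ps * val (\<sigma> y) =
            val (\<sigma> z) + val (\<sigma> p) * val (\<sigma> y)"
          unfolding *(5)[symmetric] that(3) by (simp add: algebra_simps)
      qed (use that *(2) in auto)
      ultimately show ?thesis using neqs by auto
    qed
    have "wp L (If (\<lambda>r. r p = 2) (add z y) Skip)
        (wp L (push y (\<lambda>_. 1) ;; push MulP (\<lambda>r. r p) ;; pop p) (I ps)) ts"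
    proof (cases "a = 2")
      case False
      then show ?thesis using a step[of zs] * by simp
    next
      case True
      have "wp L (add z y) (wp L (push y (\<lambda>_. 1) ;; push MulP (\<lambda>r. r p) ;; pop p) (I ps)) ts"
        unfolding *(1)
      proof (rule wp_add)
        fix zs'
        assume zs': "digits zs'" "val zs' = val (st (a # ps) us zs z) + val (st (a # ps) us zs y)"
          "length zs' = max (length (st (a # ps) us zs z)) (length (st (a # ps) us zs y)) + 1"
        have upd: "(st (a # ps) us zs)(z := zs') = st (a # ps) us zs'" by (simp add: st_def)
        show "wp L (push y (\<lambda>_. 1) ;; push MulP (\<lambda>r. r p) ;; pop p) (I ps)
            (stk ((st (a # ps) us zs)(z := zs')))"
          unfolding upd
          by (rule step[OF zs'(1)]) (use zs'(2,3) True *(4) len M in \<open>simp_all only: st val_shift\<close>, simp_all)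
      qed (use neqs dig *(3,4) len M L in auto)
      then show ?thesis using True *(1) by simp
    qed
    then show "tops ts p \<noteq> 0 \<and> wp L (If (\<lambda>r. r p = 2) (add z y) Skip ;;
        push y (\<lambda>_. 1) ;; push MulP (\<lambda>r. r p) ;; pop p) (I ps) ts"
      using a by (subst (asm) *(1), subst (1 2) *(1)) (auto simp only: wp.simps(3) tops_stk st peek.simps)
  qed
qed

section \<open>Reading the input\<close>

text \<open>Initially all heads are at \<open>0\<close>, but an empty stack has its head at
  \<open>-1\<close>, and the input becomes the stack \<open>rev w\<close> only when its head is on
  the last symbol. The loop overshoots to the first blank, so one move back follows.\<close>

definition init_heads :: "reg cmd" where
  "init_heads =
    Act (\<lambda>r s. (r s, if s = Input then Stay else Left)) ;;
    While (\<lambda>r. r Input \<noteq> 0) (Act (\<lambda>r s. (r s, if s = Input then Right else Stay))) ;;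
    Act (\<lambda>r s. (r s, if s = Input then Left else Stay))"

definition init_tapes :: "word \<Rightarrow> reg \<Rightarrow> tape" where
  "init_tapes w s = (0, word_tape (if s = Input then w else []))"

lemma wf_init_heads [simp]: "wf_cmd init_heads"
  by (simp add: init_heads_def)

lemma wp_init_heads:
  assumes w: "0 \<notin> set w" "length w \<le> L"
    and Q: "Q (stk ((\<lambda>_. [])(Input := rev w)))"
  shows "wp L init_heads Q (init_tapes w)"
proof -
  define st where "st h s = (if s = Input then (int h, word_tape w) else (-1, word_tape []))"
    for h and s :: reg
  have tops: "tops (st h) s = (if s = Input \<and> h < length w then w ! h else 0)" for h s
    by (auto simp: tops_def st_def word_tape_def)
  have move: "apply_act (\<lambda>s. (tops (st h) s, if s = Input then Right else Stay)) (st h) =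
      st (Suc h)" for h
    by (rule ext) (simp add: apply_act_def st_def tops_def)
  have halt: "apply_act (\<lambda>s. (0, if s = Input then Left else Stay)) (st (length w)) =
      stk ((\<lambda>_. [])(Input := rev w))"
    by (rule ext) (auto simp: apply_act_def st_def stk_def word_tape_def)
  have start: "apply_act (\<lambda>s. (tops (init_tapes w) s, if s = Input then Stay else Left))
      (init_tapes w) = st 0"
    by (rule ext) (simp add: apply_act_def st_def tops_def init_tapes_def)
  have "wp L (While (\<lambda>r. r Input \<noteq> 0)
      (Act (\<lambda>r s. (r s, if s = Input then Right else Stay))))
      (wp L (Act (\<lambda>r s. (r s, if s = Input then Left else Stay))) Q) (st 0)"
  proof (rule wp_While[where xs = w and
        I = "\<lambda>zs ts. \<exists>us. w = us @ zs \<and> ts = st (length us)"])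
    fix z zs ts
    assume "\<exists>us. w = us @ z # zs \<and> ts = st (length us)"
    then obtain us where us: "w = us @ z # zs" "ts = st (length us)" by blast
    then have "tops ts Input \<noteq> 0" using w(1) by (auto simp: tops nth_append)
    then show "tops ts Input \<noteq> 0 \<and> wp L (Act (\<lambda>r s. (r s, if s = Input then Right else Stay)))
        (\<lambda>ts. \<exists>us. w = us @ zs \<and> ts = st (length us)) ts"
      using us by (auto simp: move intro!: exI[of _ "us @ [z]"])
  qed (use w Q in \<open>auto simp: tops halt\<close>)
  then show ?thesis by (simp add: init_heads_def start)
qed

text \<open>A normal form for the states of the reading phase: with the simp rules below, an update
  only changes an argument, and no chains of updates pile up.\<close>

definition read_st :: "word \<Rightarrow> word \<Rightarrow> word \<Rightarrow> word \<Rightarrow> word \<Rightarrow> word \<Rightarrow> word \<Rightarrow> reg \<Rightarrow> word" where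
  "read_st i s u u' c c' r = (\<lambda>_. [])(Input := i, Scan := s, Unary := u, UnaryTemp := u',
    Counts := c, CountsTemp := c', Row := r)"

lemma read_st_lookup [simp]:
  "read_st i s u u' c c' r Input = i" "read_st i s u u' c c' r Scan = s"
  "read_st i s u u' c c' r Unary = u" "read_st i s u u' c c' r UnaryTemp = u'"
  "read_st i s u u' c c' r Counts = c" "read_st i s u u' c c' r CountsTemp = c'"
  "read_st i s u u' c c' r Row = r"
  by (simp_all add: read_st_def)

lemma read_st_update [simp]:
  "(read_st i s u u' c c' r)(Input := x) = read_st x s u u' c c' r"
  "(read_st i s u u' c c' r)(Scan := x) = read_st i x u u' c c' r"
  "(read_st i s u u' c c' r)(Unary := x) = read_st i s x u' c c' r"
  "(read_st i s u u' c c' r)(UnaryTemp := x) = read_st i s u x c c' r"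
  "(read_st i s u u' c c' r)(Counts := x) = read_st i s u u' x c' r"
  "(read_st i s u u' c c' r)(CountsTemp := x) = read_st i s u u' c x r"
  "(read_st i s u u' c c' r)(Row := x) = read_st i s u u' c c' x"
  by (auto simp: read_st_def fun_eq_iff)

text \<open>
  The agent's number is stored in unary above a symbol \<open>2\<close>. As one symbol is popped per row,
  that symbol is on top exactly in the row of the agent.
\<close>

definition read_agent :: "reg cmd" where
  "read_agent =
    push Unary (\<lambda>_. 2) ;;
    While (\<lambda>r. r Scan \<noteq> 5) (
      While (\<lambda>r. r Unary = 1) (push UnaryTemp (\<lambda>_. 1) ;; push UnaryTemp (\<lambda>_. 1) ;; pop Unary) ;;
      pour (\<lambda>a. a \<noteq> 0) UnaryTemp Unary ;;
      If (\<lambda>r. r Scan = 2) (push Unary (\<lambda>_. 1)) Skip ;;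
      pop Scan) ;;
    pop Scan"

lemma wf_read_agent [simp]: "wf_cmd read_agent"
  by (simp add: read_agent_def)

text \<open>The doubling in Horner's scheme, which takes the agent from binary to unary. The marker
  \<open>2\<close> stays at the bottom.\<close>

lemma wp_double_unary:
  assumes "2 * k \<le> L" and Q: "Q (stk (read_st i s (replicate (2 * k) 1 @ [2]) [] c c' r))"
  shows "wp L (While (\<lambda>r. r Unary = 1)
      (push UnaryTemp (\<lambda>_. 1) ;; push UnaryTemp (\<lambda>_. 1) ;; pop Unary))
    (wp L (pour (\<lambda>a. a \<noteq> 0) UnaryTemp Unary) Q) (stk (read_st i s (replicate k 1 @ [2]) [] c c' r))"
proof (rule wp_While[where xs = "replicate k ()" and I = "\<lambda>l ts. length l \<le> k \<and>
      ts = stk (read_st i s (replicate (length l) 1 @ [2]) (replicate (2 * (k - length l)) 1) c c' r)"])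
  fix x l ts
  assume *: "length (x # l) \<le> k \<and> ts = stk (read_st i s (replicate (length (x # l)) 1 @ [2])
      (replicate (2 * (k - length (x # l))) 1) c c' r)"
  then have "2 * (k - length l) = Suc (Suc (2 * (k - length (x # l))))" by auto
  then show "tops ts Unary = 1 \<and>
      wp L (push UnaryTemp (\<lambda>_. 1) ;; push UnaryTemp (\<lambda>_. 1) ;; pop Unary) (\<lambda>ts. length l \<le> k \<and>
        ts = stk (read_st i s (replicate (length l) 1 @ [2]) (replicate (2 * (k - length l)) 1) c c' r)) ts"
    using * by simp
next
  fix ts
  assume "length [] \<le> k \<and> ts = stk (read_st i s (replicate (length []) 1 @ [2])
      (replicate (2 * (k - length [])) 1) c c' r)"
  then show "\<not> tops ts Unary = 1 \<and> wp L (pour (\<lambda>a. a \<noteq> 0) UnaryTemp Unary) Q ts"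
    using assms by (auto intro!: wp_pour[where xs = "replicate (2 * k) 1" and ys = "[]"])
qed (use assms in auto)

lemma wp_read_agent:
  assumes bs: "digits bs" "length bs \<le> L" "val (rev bs) \<le> L"
    and Q: "Q (stk (read_st i s (replicate (val (rev bs)) 1 @ [2]) [] c c' r))"
  shows "wp L read_agent Q (stk (read_st i (bs @ 5 # s) [] [] c c' r))"
proof -
  let ?I = "\<lambda>zs ts. \<exists>us. bs = us @ zs \<and>
      ts = stk (read_st i (zs @ 5 # s) (replicate (val (rev us)) 1 @ [2]) [] c c' r)"
  show ?thesis
    unfolding read_agent_def wp.simps(3) wp_push
  proof (rule wp_While[where xs = bs and I = ?I])
    fix z zs ts
    assume "?I (z # zs) ts"
    then obtain us where us: "bs = us @ z # zs"
      "ts = stk (read_st i (z # zs @ 5 # s) (replicate (val (rev us)) 1 @ [2]) [] c c' r)" by auto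
    have z: "z = 1 \<or> z = 2" using us(1) bs(1) by auto
    \<comment> \<open>Twice the value of a proper prefix is at most the value of the whole numeral,
      so the bound on the agent's number also bounds each doubling.\<close>
    have "val (rev bs) = val (rev zs) + 2 ^ length zs * ((z - 1) + 2 * val (rev us))"
      using us(1) by (simp add: val_append)
    moreover have "1 * ((z - 1) + 2 * val (rev us)) \<le> 2 ^ length zs * ((z - 1) + 2 * val (rev us))"
      by (rule mult_le_mono1) simp
    ultimately have "2 * val (rev us) \<le> val (rev bs)"
      by (metis add_leD2 le_add2 le_trans mult_1)
    then have len: "2 * val (rev us) \<le> L" using bs(3) by (rule le_trans)
    have "wp L (While (\<lambda>r. r Unary = 1)
          (push UnaryTemp (\<lambda>_. 1) ;; push UnaryTemp (\<lambda>_. 1) ;; pop Unary))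
        (wp L (pour (\<lambda>a. a \<noteq> 0) UnaryTemp Unary)
          (wp L (If (\<lambda>r. r Scan = 2) (push Unary (\<lambda>_. 1)) Skip) (wp L (pop Scan) (?I zs)))) ts"
      unfolding us(2)
      by (rule wp_double_unary[OF len]) (use z us(1) in \<open>auto intro!: exI[of _ "us @ [z]"]\<close>)
    then show "tops ts Scan \<noteq> 5 \<and> wp L (
        While (\<lambda>r. r Unary = 1)
          (push UnaryTemp (\<lambda>_. 1) ;; push UnaryTemp (\<lambda>_. 1) ;; pop Unary) ;;
        pour (\<lambda>a. a \<noteq> 0) UnaryTemp Unary ;;
        If (\<lambda>r. r Scan = 2) (push Unary (\<lambda>_. 1)) Skip ;;
        pop Scan) (?I zs) ts"
      using z unfolding wp.simps(3) by (auto simp: us(2))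
  qed (use bs Q in auto)
qed

text \<open>The shares are summed in column order, so what is extracted here is the number of items:
  every comma creates one counter, a bare separator \<open>4\<close> standing for 0.\<close>

definition read_order :: "reg cmd" where
  "read_order =
    While (\<lambda>r. r Scan \<noteq> 5) (If (\<lambda>r. r Scan = 4) (push Counts (\<lambda>_. 4)) Skip ;; pop Scan) ;;
    pop Scan"

lemma wf_read_order [simp]: "wf_cmd read_order"
  by (simp add: read_order_def)

lemma wp_read_order:
  assumes xs: "5 \<notin> set xs" "length xs \<le> L"
    and Q: "Q (stk (read_st i s u u' (replicate (count_list xs 4) 4) c' r))"
  shows "wp L read_order Q (stk (read_st i (xs @ 5 # s) u u' [] c' r))"
proof -
  let ?I = "\<lambda>zs ts. \<exists>us. xs = us @ zs \<and>
      ts = stk (read_st i (zs @ 5 # s) u u' (replicate (count_list us 4) 4) c' r)"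
  show ?thesis
    unfolding read_order_def wp.simps(3)
  proof (rule wp_While[where xs = xs and I = ?I])
    fix z zs ts
    assume "?I (z # zs) ts"
    then obtain us where us: "xs = us @ z # zs"
      "ts = stk (read_st i (z # zs @ 5 # s) u u' (replicate (count_list us 4) 4) c' r)" by auto
    then have "z \<noteq> 5" using xs(1) by auto
    then show "tops ts Scan \<noteq> 5 \<and>
        wp L (If (\<lambda>r. r Scan = 4) (push Counts (\<lambda>_. 4)) Skip ;; pop Scan) (?I zs) ts"
      using us by (auto intro!: exI[of _ "us @ [z]"])
  qed (use xs Q in auto)
qed

text \<open>
  The stack \<open>Counts\<close> holds, in unary, the number of bidders for every column in the rows read
  so far.
\<close>

definition cells :: "word list \<Rightarrow> word" where
  "cells xs = concat (map (\<lambda>x. x @ [4]) xs)"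

definition counts :: "nat list \<Rightarrow> word" where
  "counts cs = concat (map (\<lambda>c. replicate c 1 @ [4]) cs)"

lemma cells_simps [simp]: "cells [] = []" "cells (x # xs) = x @ 4 # cells xs"
    "cells (xs @ ys) = cells xs @ cells ys"
  and counts_simps [simp]: "counts [] = []" "counts (c # cs) = replicate c 1 @ 4 # counts cs"
    "counts (cs @ ds) = counts cs @ counts ds"
  by (simp_all add: cells_def counts_def)

text \<open>A utility is positive iff its numerator has the leading digit \<open>1\<close>, written as the symbol \<open>2\<close>.\<close>

definition bump :: "word \<Rightarrow> nat \<Rightarrow> nat" where
  "bump x c = c + (if hd x = 2 then 1 else 0)"

text \<open>Cells and counters are consumed in lockstep. The positivity test must come before the
  cell is poured or dropped, while the leading digit of the numerator is on top of
  \<open>Scan\<close>.\<close>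

definition read_cell :: "reg cmd" where
  "read_cell =
    pour (\<lambda>a. a = 1) Counts CountsTemp ;;
    If (\<lambda>r. r Scan = 2) (push CountsTemp (\<lambda>_. 1)) Skip ;;
    pop Counts ;;
    push CountsTemp (\<lambda>_. 4) ;;
    If (\<lambda>r. r Unary = 2)
      (pour (\<lambda>a. a \<noteq> 4) Scan Row ;; push Row (\<lambda>_. 4)) (drop_while (\<lambda>a. a \<noteq> 4) Scan) ;;
    pop Scan"

definition read_row :: "reg cmd" where
  "read_row =
    While (\<lambda>r. r Scan \<noteq> 5) read_cell ;;
    pop Scan ;;
    pour (\<lambda>a. a \<noteq> 0) CountsTemp Counts ;;
    If (\<lambda>r. r Unary \<noteq> 0) (pop Unary) Skip"

definition read_rows :: "reg cmd" where
  "read_rows = While (\<lambda>r. r Scan \<noteq> 0) read_row"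

lemma wf_read_rows [simp]: "wf_cmd read_rows"
  by (simp add: read_rows_def read_row_def read_cell_def)

lemma wp_read_cell:
  assumes x: "x \<noteq> []" "set x \<subseteq> {1, 2, 3}" "length x \<le> L" "c \<le> L"
    and Q: "Q (stk (read_st i s u u' cs (rev (replicate (bump x c) 1 @ [4]) @ cs')
      (if peek u = 2 then rev (x @ [4]) @ r else r)))"
  shows "wp L read_cell Q (stk (read_st i (x @ 4 # s) u u' (replicate c 1 @ 4 # cs) cs' r))"
proof -
  have peek: "peek (x @ ys) = hd x" for ys using x(1) by (cases x) auto
  have scan: "wp L (If (\<lambda>r. r Unary = 2)
      (pour (\<lambda>a. a \<noteq> 4) Scan Row ;; push Row (\<lambda>_. 4)) (drop_while (\<lambda>a. a \<noteq> 4) Scan))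
      (wp L (pop Scan) Q)
      (stk (read_st i (x @ 4 # s) u u' cs (rev (replicate (bump x c) 1 @ [4]) @ cs') r))"
  proof (cases "peek u = 2")
    case True
    have "wp L (pour (\<lambda>a. a \<noteq> 4) Scan Row) (wp L (push Row (\<lambda>_. 4)) (wp L (pop Scan) Q))
      (stk (read_st i (x @ 4 # s) u u' cs (rev (replicate (bump x c) 1 @ [4]) @ cs') r))"
      by (rule wp_pour[where xs = x and ys = "4 # s"]) (use x Q True in auto)
    then show ?thesis using True by simp
  next
    case False
    have "wp L (drop_while (\<lambda>a. a \<noteq> 4) Scan) (wp L (pop Scan) Q)
      (stk (read_st i (x @ 4 # s) u u' cs (rev (replicate (bump x c) 1 @ [4]) @ cs') r))"
      by (rule wp_drop_while[where xs = x and ys = "4 # s"]) (use x Q False in auto)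
    then show ?thesis using False by simp
  qed
  show ?thesis
    unfolding read_cell_def wp.simps(3)
    by (rule wp_pour[where xs = "replicate c 1" and ys = "4 # cs"])
      (use x(4) scan in \<open>auto simp: peek bump_def replicate_append_same simp del: wp.simps(4)
        simp: wp.simps(4)[where b = "\<lambda>r. r Scan = 2"]\<close>)
qed

text \<open>The counters pile up reversed in \<open>CountsTemp\<close> and are poured back after the
  row. \<open>Row\<close> keeps the agent's row upside down, so that one later pour into
  \<open>Scan\<close> restores the reading order. As \<open>0\<close> does not occur in
  \<open>u\<close>, its top symbol tells whether it is empty.\<close>

lemma wp_read_row:
  assumes len: "length xs = length cs"
    and xs: "\<forall>x \<in> set xs. x \<noteq> [] \<and> set x \<subseteq> {1, 2, 3} \<and> length x \<le> L"
    and cs: "\<forall>c \<in> set cs. c \<le> L"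
    and L: "length xs \<le> L" "length (counts (map2 bump xs cs)) \<le> L"
    and Q: "Q (stk (read_st i s (tl u) u' (counts (map2 bump xs cs)) []
      (if peek u = 2 then rev (cells xs) @ r else r)))"
    and u: "0 \<notin> set u"
  shows "wp L read_row Q (stk (read_st i (cells xs @ 5 # s) u u' (counts cs) [] r))"
proof -
  let ?I = "\<lambda>zs ts. \<exists>us. zip xs cs = us @ zs \<and> ts = stk (read_st i (cells (map fst zs) @ 5 # s) u u'
      (counts (map snd zs)) (rev (counts (map (\<lambda>(x, c). bump x c) us)))
      (if peek u = 2 then rev (cells (map fst us)) @ r else r))"
  show ?thesis
    unfolding read_row_def wp.simps(3)
  proof (rule wp_While[where xs = "zip xs cs" and I = ?I])
    fix z zs ts
    assume "?I (z # zs) ts"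
    then obtain us x c where us: "zip xs cs = us @ (x, c) # zs" "z = (x, c)"
      "ts = stk (read_st i (x @ 4 # cells (map fst zs) @ 5 # s) u u'
      (replicate c 1 @ 4 # counts (map snd zs)) (rev (counts (map (\<lambda>(x, c). bump x c) us)))
      (if peek u = 2 then rev (cells (map fst us)) @ r else r))" by (cases z) auto
    have "(x, c) \<in> set (zip xs cs)" using us(1) by simp
    then have xc: "x \<in> set xs" "c \<in> set cs" by (auto dest: set_zip_leftD set_zip_rightD)
    then have "x \<noteq> []" "set x \<subseteq> {1, 2, 3}" using xs by auto
    then have "peek (x @ ys) \<noteq> 5" for ys by (cases x) auto
    moreover have "wp L read_cell (?I zs) ts"
      unfolding us(3) by (rule wp_read_cell)
        (use xs cs xc us(1) in \<open>auto intro!: exI[of _ "us @ [(x, c)]"]\<close>)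
    ultimately show "tops ts Scan \<noteq> 5 \<and> wp L read_cell (?I zs) ts"
      by (simp add: us(3))
  next
    fix ts
    assume "?I [] ts"
    then have ts: "ts = stk (read_st i (5 # s) u u' [] (rev (counts (map2 bump xs cs)))
      (if peek u = 2 then rev (cells xs) @ r else r))" using len by auto
    have "peek u = 0 \<longleftrightarrow> u = []" using u by (cases u) auto
    then have "wp L (If (\<lambda>r. r Unary \<noteq> 0) (pop Unary) Skip) Q
      (stk (read_st i s u u' (counts (map2 bump xs cs)) []
        (if peek u = 2 then rev (cells xs) @ r else r)))"
      using Q by auto
    moreover have "\<forall>x \<in> set (counts (map2 bump xs cs)). x \<noteq> 0"
      by (auto simp: counts_def)
    ultimately have "wp L (pour (\<lambda>a. a \<noteq> 0) CountsTemp Counts)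
      (wp L (If (\<lambda>r. r Unary \<noteq> 0) (pop Unary) Skip) Q)
      (stk (read_st i s u u' [] (rev (counts (map2 bump xs cs)))
        (if peek u = 2 then rev (cells xs) @ r else r)))"
      using L by (intro wp_pour[where xs = "rev (counts (map2 bump xs cs))" and ys = "[]"])
        (simp_all del: wp.simps)
    then show "\<not> tops ts Scan \<noteq> 5 \<and> wp L (pop Scan)
      (wp L (pour (\<lambda>a. a \<noteq> 0) CountsTemp Counts)
        (wp L (If (\<lambda>r. r Unary \<noteq> 0) (pop Unary) Skip) Q)) ts"
      by (simp add: ts del: wp.simps)
  qed (use len L in auto)
qed

text \<open>For the coded utility matrix this is the number of bidders for item
  \<open>k\<close>.\<close>

definition column_count :: "word list list \<Rightarrow> nat \<Rightarrow> nat" where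
  "column_count X k = length (filter (\<lambda>r. hd (r ! k) = 2) X)"

lemma counts_snoc_row:
  assumes "length xs = m"
  shows "map2 bump xs (map (column_count Z) [0..<m]) = map (column_count (Z @ [xs])) [0..<m]"
  by (rule nth_equalityI) (use assms in \<open>auto simp: bump_def column_count_def\<close>)

lemma column_count_le: "column_count X k \<le> length X"
  by (simp add: column_count_def)

lemma length_counts_le:
  "\<forall>c \<in> set cs. c \<le> b \<Longrightarrow> length (counts cs) \<le> length cs * (b + 1)"
  by (induction cs) auto

text \<open>The bound \<open>m * (length X + 1)\<close> is the space for \<open>m\<close> unary
  counters with their separators, all of which are poured in a single loop after each row.\<close>

lemma wp_read_rows:
  assumes X: "\<forall>r \<in> set X. length r = m \<and>
      (\<forall>x \<in> set r. x \<noteq> [] \<and> set x \<subseteq> {1, 2, 3} \<and> length x \<le> L)"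
    and i: "i < length X"
    and L: "m \<le> L" "length X \<le> L" "m * (length X + 1) \<le> L"
    and Q: "Q (stk (read_st inp [] [] [] (counts (map (column_count X) [0..<m])) [] (rev (cells (X ! i)))))"
  shows "wp L read_rows Q (stk (read_st inp (concat (map (\<lambda>r. cells r @ [5]) X))
      (replicate i 1 @ [2]) [] (replicate m 4) [] []))"
proof -
  \<comment> \<open>The contents of \<open>Unary\<close> after \<open>j\<close> rows;
    \<open>drop\<close> makes it empty once the agent's row has been passed.\<close>
  define u where "u j = drop j (replicate i 1 @ [2 :: nat])" for j
  let ?I = "\<lambda>Y ts. \<exists>Z. X = Z @ Y \<and> ts = stk (read_st inp (concat (map (\<lambda>r. cells r @ [5]) Y))
      (u (length Z)) [] (counts (map (column_count Z) [0..<m])) []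
      (if i < length Z then rev (cells (X ! i)) else []))"
  have peek_u: "peek (u j) = (if j < i then 1 else if j = i then 2 else 0)" for j
    by (cases "i - j") (auto simp: u_def not_less)
  show ?thesis
    unfolding read_rows_def
  proof (rule wp_While[where xs = X and I = ?I])
    fix xs Y ts
    assume "?I (xs # Y) ts"
    then obtain Z where Z: "X = Z @ xs # Y"
      "ts = stk (read_st inp (cells xs @ 5 # concat (map (\<lambda>r. cells r @ [5]) Y))
        (u (length Z)) [] (counts (map (column_count Z) [0..<m])) []
        (if i < length Z then rev (cells (X ! i)) else []))" by auto
    have xs: "length xs = m" "\<forall>x \<in> set xs. x \<noteq> [] \<and> set x \<subseteq> {1, 2, 3} \<and> length x \<le> L"
      using X Z(1) by auto
    have "peek (cells xs @ 5 # w) \<noteq> 0" for w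
    proof (cases xs)
      case (Cons y ys)
      then show ?thesis using xs(2) by (cases y) auto
    qed simp
    moreover have "wp L read_row (?I Y) ts"
      unfolding Z(2)
    proof (rule wp_read_row, unfold counts_snoc_row[OF xs(1)])
      have "length (counts (map (column_count (Z @ [xs])) [0..<m])) \<le>
          length (map (column_count (Z @ [xs])) [0..<m]) * (length X + 1)"
        by (rule length_counts_le) (use Z(1) in \<open>auto intro: order_trans[OF column_count_le]\<close>)
      then show "length (counts (map (column_count (Z @ [xs])) [0..<m])) \<le> L" using L(3) by simp
      show "\<forall>c \<in> set (map (column_count Z) [0..<m]). c \<le> L"
        using Z(1) L(2) by (auto intro: order_trans[OF column_count_le])
      show "0 \<notin> set (u (length Z))" by (auto simp: u_def dest: in_set_dropD)
      have "tl (u (length Z)) = u (length (Z @ [xs]))"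
        by (simp add: u_def drop_Suc tl_drop del: drop_append)
      then show "?I Y (stk (read_st inp (concat (map (\<lambda>r. cells r @ [5]) Y)) (tl (u (length Z))) []
          (counts (map (column_count (Z @ [xs])) [0..<m])) []
          (if peek (u (length Z)) = 2
           then rev (cells xs) @ (if i < length Z then rev (cells (X ! i)) else [])
           else if i < length Z then rev (cells (X ! i)) else [])))"
        using Z(1) by (intro exI[of _ "Z @ [xs]"]) (auto simp: peek_u nth_append)
    qed (use xs L in auto)
    ultimately show "tops ts Scan \<noteq> 0 \<and> wp L read_row (?I Y) ts"
      by (simp add: Z(2))
  next
    fix ts
    assume "?I [] ts"
    moreover have "u (length X) = []" using i by (simp add: u_def)
    ultimately show "\<not> tops ts Scan \<noteq> 0 \<and> Q ts" using i Q by auto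
  next
    have "counts (map (column_count []) [0..<m]) = replicate m 4"
      by (induction m) (auto simp: column_count_def replicate_append_same)
    then show "?I X (stk (read_st inp (concat (map (\<lambda>r. cells r @ [5]) X))
        (replicate i 1 @ [2]) [] (replicate m 4) [] []))"
      by (intro exI[of _ "[]"]) (simp add: u_def)
  qed (use L in auto)
qed

section \<open>Summing the shares\<close>

definition sum_st :: "word \<Rightarrow> word \<Rightarrow> word \<Rightarrow> word \<Rightarrow> word \<Rightarrow> word \<Rightarrow> word \<Rightarrow> word \<Rightarrow> word \<Rightarrow> word \<Rightarrow>
    word \<Rightarrow> word \<Rightarrow> reg \<Rightarrow> word" where
  "sum_st s c a b k e n d n' d' t out = (\<lambda>_. [])(Scan := s, Counts := c, Numer := a, Denom := b,
    Count := k, Scaled := e, SumN := n, SumD := d, NewN := n', NewD := d', MulP := t,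
    Output := out)"

lemma sum_st_lookup [simp]:
  "sum_st s c a b k e n d n' d' t out Scan = s" "sum_st s c a b k e n d n' d' t out Counts = c"
  "sum_st s c a b k e n d n' d' t out Numer = a" "sum_st s c a b k e n d n' d' t out Denom = b"
  "sum_st s c a b k e n d n' d' t out Count = k" "sum_st s c a b k e n d n' d' t out Scaled = e"
  "sum_st s c a b k e n d n' d' t out SumN = n" "sum_st s c a b k e n d n' d' t out SumD = d"
  "sum_st s c a b k e n d n' d' t out NewN = n'" "sum_st s c a b k e n d n' d' t out NewD = d'"
  "sum_st s c a b k e n d n' d' t out MulP = t" "sum_st s c a b k e n d n' d' t out Output = out"
  "sum_st s c a b k e n d n' d' t out AddZ = []" "sum_st s c a b k e n d n' d' t out AddY = []"
  "sum_st s c a b k e n d n' d' t out Carry = []"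
  by (simp_all add: sum_st_def)

lemma sum_st_update [simp]:
  "(sum_st s c a b k e n d n' d' t out)(Scan := x) = sum_st x c a b k e n d n' d' t out"
  "(sum_st s c a b k e n d n' d' t out)(Counts := x) = sum_st s x a b k e n d n' d' t out"
  "(sum_st s c a b k e n d n' d' t out)(Numer := x) = sum_st s c x b k e n d n' d' t out"
  "(sum_st s c a b k e n d n' d' t out)(Denom := x) = sum_st s c a x k e n d n' d' t out"
  "(sum_st s c a b k e n d n' d' t out)(Count := x) = sum_st s c a b x e n d n' d' t out"
  "(sum_st s c a b k e n d n' d' t out)(Scaled := x) = sum_st s c a b k x n d n' d' t out"
  "(sum_st s c a b k e n d n' d' t out)(SumN := x) = sum_st s c a b k e x d n' d' t out"
  "(sum_st s c a b k e n d n' d' t out)(SumD := x) = sum_st s c a b k e n x n' d' t out"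
  "(sum_st s c a b k e n d n' d' t out)(NewN := x) = sum_st s c a b k e n d x d' t out"
  "(sum_st s c a b k e n d n' d' t out)(NewD := x) = sum_st s c a b k e n d n' x t out"
  "(sum_st s c a b k e n d n' d' t out)(MulP := x) = sum_st s c a b k e n d n' d' x out"
  "(sum_st s c a b k e n d n' d' t out)(Output := x) = sum_st s c a b k e n d n' d' t x"
  by (auto simp: sum_st_def fun_eq_iff)

text \<open>
  The count is raised to at least \<open>1\<close>, which keeps the denominator positive. This is harmless,
  because the numerator is \<open>0\<close> for items without bidders.
\<close>

definition read_share :: "reg cmd" where
  "read_share =
    pour (\<lambda>a. a \<noteq> 3) Scan Numer ;; pop Scan ;;
    pour (\<lambda>a. a \<noteq> 4) Scan Denom ;; pop Scan ;;
    pour (\<lambda>a. a = 1) Counts Count ;; pop Counts ;;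
    If (\<lambda>r. r Count = 0) (push Count (\<lambda>_. 1)) Skip"

lemma digits_neq:
  assumes "digits xs" "x \<in> set xs"
  shows "x \<noteq> 0" "x \<noteq> 3" "x \<noteq> 4" "x \<noteq> 5"
  using assms by auto

lemma wp_read_share:
  assumes "digits as" "digits bs" "length as \<le> L" "length bs \<le> L" "k \<le> L"
    and Q: "Q (stk (sum_st s c (rev as) (rev bs) (replicate (max 1 k) 1) e n d n' d' t out))"
  shows "wp L read_share Q (stk (sum_st (as @ 3 # bs @ 4 # s) (replicate k 1 @ 4 # c) [] [] []
    e n d n' d' t out))"
proof -
  note neq = assms(1,2)[THEN digits_neq(2)] assms(1,2)[THEN digits_neq(3)]
  have "wp L (If (\<lambda>r. r Count = 0) (push Count (\<lambda>_. 1)) Skip) Q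
    (stk (sum_st s c (rev as) (rev bs) (replicate k 1) e n d n' d' t out))"
    using Q by (cases k) auto
  then have "wp L (pour (\<lambda>a. a = 1) Counts Count) (wp L (pop Counts)
      (wp L (If (\<lambda>r. r Count = 0) (push Count (\<lambda>_. 1)) Skip) Q))
    (stk (sum_st s (replicate k 1 @ 4 # c) (rev as) (rev bs) [] e n d n' d' t out))"
    by (intro wp_pour[where xs = "replicate k 1" and ys = "4 # c"])
      (use assms in \<open>auto simp del: wp.simps\<close>)
  then have "wp L (pour (\<lambda>a. a \<noteq> 4) Scan Denom) (wp L (pop Scan)
      (wp L (pour (\<lambda>a. a = 1) Counts Count) (wp L (pop Counts)
        (wp L (If (\<lambda>r. r Count = 0) (push Count (\<lambda>_. 1)) Skip) Q))))
    (stk (sum_st (bs @ 4 # s) (replicate k 1 @ 4 # c) (rev as) [] [] e n d n' d' t out))"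
    by (intro wp_pour[where xs = bs and ys = "4 # s"])
      (use assms neq in \<open>auto simp del: wp.simps\<close>)
  then show ?thesis
    unfolding read_share_def wp.simps(3)
    by (intro wp_pour[where xs = as and ys = "3 # bs @ 4 # s" and s = Scan and t = Numer])
      (use assms neq in \<open>auto simp del: wp.simps\<close>)
qed

definition scale_denom :: "reg cmd" where
  "scale_denom = While (\<lambda>r. r Count \<noteq> 0) (add Scaled Denom ;; pop Count)"

text \<open>The factor \<open>k\<close> is in unary, so repeated addition is affordable. Each
  addition adds at most one digit, which gives \<open>length b + k\<close>.\<close>

lemma wp_scale_denom:
  assumes b: "digits b" and L: "length b + k < L"
    and Q: "\<And>e. digits e \<Longrightarrow> val e = k * val b \<Longrightarrow> length e \<le> length b + k \<Longrightarrow>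
      Q (stk (sum_st s c a b [] e n d n' d' t out))"
  shows "wp L scale_denom Q (stk (sum_st s c a b (replicate k 1) [] n d n' d' t out))"
  unfolding scale_denom_def
proof (rule wp_While[where xs = "replicate k ()" and I = "\<lambda>l ts. length l \<le> k \<and>
      (\<exists>e. digits e \<and> val e = (k - length l) * val b \<and> length e \<le> length b + (k - length l) \<and>
        ts = stk (sum_st s c a b (replicate (length l) 1) e n d n' d' t out))"])
  fix x :: unit and l ts
  let ?I = "\<lambda>l ts. length l \<le> k \<and>
      (\<exists>e. digits e \<and> val e = (k - length l) * val b \<and> length e \<le> length b + (k - length l) \<and>
        ts = stk (sum_st s c a b (replicate (length l) 1) e n d n' d' t out))"
  assume "?I (x # l) ts"
  then obtain e where l: "Suc (length l) \<le> k" and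
    e: "digits e" "val e = (k - Suc (length l)) * val b" "length e \<le> length b + (k - Suc (length l))"
      "ts = stk (sum_st s c a b (replicate (Suc (length l)) 1) e n d n' d' t out)" by auto
  have k: "k - length l = Suc (k - Suc (length l))" using l by simp
  have "wp L (add Scaled Denom) (wp L (pop Count) (?I l)) ts"
    unfolding e(4) by (rule wp_add) (use b e(1-3) l k L in auto)
  then show "tops ts Count \<noteq> 0 \<and> wp L (add Scaled Denom ;; pop Count) (?I l) ts"
    by (simp add: e(4))
qed (use Q L in \<open>auto intro: exI[of _ "[]"]\<close>)

text \<open>A pour reverses a stack, so two of them preserve the order of the digits.\<close>

definition move :: "reg \<Rightarrow> reg \<Rightarrow> reg cmd" where
  "move s t = pour (\<lambda>a. a \<noteq> 0) s MulP ;; pour (\<lambda>a. a \<noteq> 0) MulP t"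

definition clear :: "reg \<Rightarrow> reg cmd" where
  "clear s = drop_while (\<lambda>a. a \<noteq> 0) s"

lemma wp_move:
  assumes "s \<noteq> t" "s \<noteq> MulP" "t \<noteq> MulP" "\<sigma> MulP = []" "\<sigma> t = []" "digits (\<sigma> s)" "length (\<sigma> s) \<le> L"
    and Q: "Q (stk (\<sigma>(s := [], t := \<sigma> s)))"
  shows "wp L (move s t) Q (stk \<sigma>)"
proof -
  have neq: "\<forall>x \<in> set (\<sigma> s). x \<noteq> 0" using assms(6) by auto
  have "\<sigma>(s := [], MulP := [], t := \<sigma> s) = \<sigma>(s := [], t := \<sigma> s)"
    using assms by (auto simp: fun_eq_iff)
  then have "wp L (pour (\<lambda>a. a \<noteq> 0) MulP t) Q (stk (\<sigma>(s := [], MulP := rev (\<sigma> s))))"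
    by (intro wp_pour[where xs = "rev (\<sigma> s)" and ys = "[]"]) (use assms neq in auto)
  then show ?thesis
    unfolding move_def wp.simps(3)
    by (intro wp_pour[where xs = "\<sigma> s" and ys = "[]" and t = MulP]) (use assms neq in auto)
qed

lemma wp_clear:
  assumes "digits (\<sigma> s)" "length (\<sigma> s) \<le> L" and Q: "Q (stk (\<sigma>(s := [])))"
  shows "wp L (clear s) Q (stk \<sigma>)"
  unfolding clear_def
  by (rule wp_drop_while[where xs = "\<sigma> s" and ys = "[]"])
    (use assms in \<open>auto dest: digits_neq(1)\<close>)

definition replace_sum :: "reg cmd" where
  "replace_sum =
    clear Numer ;; clear Denom ;; clear Scaled ;; clear SumN ;; clear SumD ;;
    move NewN SumN ;; move NewD SumD"

lemma wp_replace_sum: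
  assumes dig: "digits a" "digits b" "digits e" "digits n" "digits d" "digits n'" "digits d'"
    and len: "length a \<le> L" "length b \<le> L" "length e \<le> L" "length n \<le> L" "length d \<le> L"
      "length n' \<le> L" "length d' \<le> L"
    and Q: "Q (stk (sum_st s c [] [] [] [] n' d' [] [] [] out))"
  shows "wp L replace_sum Q (stk (sum_st s c a b [] e n d n' d' [] out))"
  unfolding replace_sum_def wp.simps(3)
  by ((rule wp_clear, use dig len in simp, use len in simp, unfold sum_st_update)+,
    (rule wp_move, simp, simp, simp, simp, simp, use dig in simp, use len in simp,
      unfold sum_st_update sum_st_lookup)+) (rule Q)

text \<open>With e the scaled denominator, N/D + a/e = (N * e + a * D) / (e * D). The first two
  products accumulate in \<open>NewN\<close>.\<close>

definition add_share :: "reg cmd" where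
  "add_share =
    mac Scaled SumN NewN ;; mac Numer SumD NewN ;; mac Scaled SumD NewD ;; replace_sum"

lemma wp_add_share:
  assumes dig: "digits a" "digits b" "digits e" "digits n" "digits d"
    and len: "length a \<le> g" "length b \<le> g" "length e \<le> g" "length n \<le> l" "length d \<le> l"
    and L: "l + 3 * g < L"
    and Q: "\<And>n' d'. digits n' \<Longrightarrow> digits d' \<Longrightarrow> val n' = val e * val n + val a * val d \<Longrightarrow>
      val d' = val e * val d \<Longrightarrow> length n' \<le> l + 3 * g \<Longrightarrow> length d' \<le> l + 3 * g \<Longrightarrow>
      Q (stk (sum_st s c [] [] [] [] n' d' [] [] [] out))"
  shows "wp L add_share Q (stk (sum_st s c a b [] e n d [] [] [] out))"
  unfolding add_share_def wp.simps(3)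
\<comment> \<open>Goal 15 is the continuation \<open>Q\<close> of \<open>wp_mac\<close>. The second
  product starts from a \<open>NewN\<close> of length up to \<open>l + 2 * g\<close>, which dictates
  its \<open>M\<close> and leads to the final \<open>l + 3 * g\<close>.\<close>
proof (rule wp_mac[where M = "l + g"], goal_cases)
  case (15 n1)
  note n1 = this
  show ?case
    unfolding sum_st_update
  proof (rule wp_mac[where M = "l + 2 * g"], goal_cases)
    case (15 n2)
    note n2 = this
    show ?case
      unfolding sum_st_update
    proof (rule wp_mac[where M = "l + g"], goal_cases)
      case (15 d1)
      note d1 = this
      show ?case
        unfolding sum_st_update
      proof (rule wp_replace_sum)
        show "Q (stk (sum_st s c [] [] [] [] n2 d1 [] [] [] out))"
          by (rule Q) (use n1 n2 d1 len in simp_all)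
      qed (use n1 n2 d1 assms in simp_all)
    qed (use n1 n2 assms in simp_all)
  qed (use n1 assms in simp_all)
qed (use assms in simp_all)

subsection \<open>Binary notation\<close>

lemma binary_less_2: "a < 2 \<Longrightarrow> binary a = [a + 1]"
  and binary_ge_2: "\<not> a < 2 \<Longrightarrow> binary a = binary (a div 2) @ [a mod 2 + 1]"
  by (simp_all add: binary.simps[of a] digit_def)

lemma digits_binary: "digits (binary a)"
proof (induction a rule: binary.induct)
  case (1 a)
  then show ?case by (cases "a < 2") (auto simp: binary_less_2 binary_ge_2)
qed

lemma val_rev_binary [simp]: "val (rev (binary a)) = a"
proof (induction a rule: binary.induct)
  case (1 a)
  then show ?case by (cases "a < 2") (auto simp: binary_less_2 binary_ge_2)
qed

lemma binary_not_Nil [simp]: "binary a \<noteq> []"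
  by (cases "a < 2") (simp_all add: binary_less_2 binary_ge_2)

text \<open>Only the numeral of 0 starts with the digit 0; this justifies deciding positivity from a
  single symbol.\<close>

lemma hd_binary: "hd (binary a) = 2 \<longleftrightarrow> a > 0"
proof (induction a rule: binary.induct)
  case (1 a)
  show ?case
  proof (cases "a < 2")
    case False
    then show ?thesis using 1 by (simp add: binary_ge_2)
  qed (auto simp: binary_less_2)
qed

text \<open>Numerals without leading zeros are unique, so a number stripped of its leading zeros is
  already in the form demanded by \<open>rat_code\<close>.\<close>

lemma binary_val_rev:
  "digits ys \<Longrightarrow> ys \<noteq> [] \<Longrightarrow> hd ys = 2 \<Longrightarrow> binary (val (rev ys)) = ys"
proof (induction ys rule: rev_induct)
  case (snoc y ys)
  then have y: "y = 1 \<or> y = 2" by auto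
  show ?case
  proof (cases "ys = []")
    case True
    then show ?thesis using snoc by (simp add: binary_less_2)
  next
    case False
    with snoc have IH: "binary (val (rev ys)) = ys" "hd ys = 2" by auto
    then have "val (rev ys) > 0" using hd_binary[of "val (rev ys)"] by simp
    then show ?thesis using y IH by (auto simp: binary_ge_2)
  qed
qed simp

lemma val_strip: "val (rev (dropWhile (\<lambda>a. a = 1) xs)) = val (rev xs)"
  by (induction xs) (auto simp: val_append)

subsection \<open>Sum and output\<close>

definition sum_shares :: "reg cmd" where
  "sum_shares = While (\<lambda>r. r Scan \<noteq> 0) (read_share ;; scale_denom ;; add_share)"

lemma wf_sum_shares [simp]: "wf_cmd sum_shares"
  by (simp add: sum_shares_def read_share_def scale_denom_def add_share_def replace_sum_def
      move_def clear_def)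

definition fraction_word :: "nat \<times> nat \<times> nat \<Rightarrow> word" where
  "fraction_word = (\<lambda>(a, b, k). binary a @ 3 # binary b)"

definition share :: "nat \<times> nat \<times> nat \<Rightarrow> rat" where
  "share = (\<lambda>(a, b, k). of_nat a / (of_nat (max 1 k) * of_nat b))"

lemma wp_sum_shares:
  assumes ps: "\<And>a b k. (a, b, k) \<in> set ps \<Longrightarrow>
      b > 0 \<and> length (binary a) \<le> h \<and> length (binary b) \<le> h \<and> k \<le> h"
    and L: "1 + 3 * (2 * h + 1) * length ps < L" "length ps \<le> L"
    and Q: "\<And>n d. digits n \<Longrightarrow> digits d \<Longrightarrow> length n < L \<Longrightarrow> length d < L \<Longrightarrow> val d > 0 \<Longrightarrow>
      of_nat (val n) / of_nat (val d) = sum_list (map share ps) \<Longrightarrow>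
      Q (stk (sum_st [] [] [] [] [] [] n d [] [] [] out))"
  shows "wp L sum_shares Q (stk (sum_st (cells (map fraction_word ps))
    (counts (map (snd \<circ> snd) ps)) [] [] [] [] [] [2] [] [] [] out))"
proof -
  \<comment> \<open>The scaled denominator dominates: its length is at most
    \<open>length (binary b) + max 1 k\<close>, hence at most \<open>h + (h + 1)\<close>.\<close>
  define g where "g = 2 * h + 1"
  define I where "I qs ts \<longleftrightarrow> (\<exists>us n d. ps = us @ qs \<and> digits n \<and> digits d \<and>
      length n \<le> 1 + 3 * g * length us \<and> length d \<le> 1 + 3 * g * length us \<and> val d > 0 \<and>
      of_nat (val n) / of_nat (val d) = sum_list (map share us) \<and>
      ts = stk (sum_st (cells (map fraction_word qs)) (counts (map (snd \<circ> snd) qs))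
        [] [] [] [] n d [] [] [] out))" for qs ts
  show ?thesis
    unfolding sum_shares_def
  proof (rule wp_While[where xs = ps and I = I])
    \<comment> \<open>The sum starts as 0/1, with the empty word for 0 and \<open>[2]\<close> for 1.
      The length of the latter is the summand \<open>1\<close> in the length bounds.\<close>
    show "I ps (stk (sum_st (cells (map fraction_word ps))
        (counts (map (snd \<circ> snd) ps)) [] [] [] [] [] [2] [] [] [] out))"
      unfolding I_def by (rule exI[of _ "[]"], rule exI[of _ "[]"], rule exI[of _ "[2]"]) simp
  next
    fix ts
    assume "I [] ts"
    then obtain n d where nd: "digits n" "digits d" "length n \<le> 1 + 3 * g * length ps"
      "length d \<le> 1 + 3 * g * length ps" "val d > 0"
      "of_nat (val n) / of_nat (val d) = sum_list (map share ps)"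
      "ts = stk (sum_st [] [] [] [] [] [] n d [] [] [] out)" by (auto simp: I_def)
    then have "Q ts" using L(1) by (auto simp: g_def intro!: Q)
    then show "\<not> tops ts Scan \<noteq> 0 \<and> Q ts" using nd(7) by simp
  next
    fix p qs ts
    assume "I (p # qs) ts"
    moreover obtain a b k where p: "p = (a, b, k)" by (cases p)
    ultimately obtain us n d where us: "ps = us @ (a, b, k) # qs" "digits n" "digits d"
      "length n \<le> 1 + 3 * g * length us" "length d \<le> 1 + 3 * g * length us" "val d > 0"
      "of_nat (val n) / of_nat (val d) = sum_list (map share us)"
      and ts: "ts = stk (sum_st (binary a @ 3 # binary b @ 4 # cells (map fraction_word qs))
        (replicate k 1 @ 4 # counts (map (snd \<circ> snd) qs)) [] [] [] [] n d [] [] [] out)"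
      by (auto simp: I_def fraction_word_def)
    have abk: "b > 0" "length (binary a) \<le> h" "length (binary b) \<le> h" "k \<le> h"
      using ps us(1) by auto
    have "1 + 3 * g * length us + 3 * g \<le> 1 + 3 * g * length ps" using us(1) by simp
    also have "\<dots> < L" using L(1) by (simp add: g_def)
    finally have bound: "1 + 3 * g * length us + 3 * g < L" .
    then have gL: "3 * g < L" by linarith
    have "wp L read_share (wp L scale_denom (wp L add_share (I qs))) ts"
      unfolding ts
    proof (rule wp_read_share)
      show "wp L scale_denom (wp L add_share (I qs)) (stk (sum_st (cells (map fraction_word qs))
          (counts (map (snd \<circ> snd) qs)) (rev (binary a)) (rev (binary b))
          (replicate (max 1 k) 1) [] n d [] [] [] out))"
      proof (rule wp_scale_denom)
        fix e
        assume e: "digits e" "val e = max 1 k * val (rev (binary b))"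
          "length e \<le> length (rev (binary b)) + max 1 k"
        show "wp L add_share (I qs) (stk (sum_st (cells (map fraction_word qs))
          (counts (map (snd \<circ> snd) qs)) (rev (binary a)) (rev (binary b)) [] e n d [] [] [] out))"
        proof (rule wp_add_share[where g = g and l = "1 + 3 * g * length us"])
          fix n' d'
          assume n': "digits n'" "digits d'" "val n' = val e * val n + val (rev (binary a)) * val d"
            "val d' = val e * val d" "length n' \<le> 1 + 3 * g * length us + 3 * g"
            "length d' \<le> 1 + 3 * g * length us + 3 * g"
          have e_pos: "val e > 0" using abk(1) by (simp add: e(2))
          have "share (a, b, k) = of_nat a / of_nat (val e)"
            unfolding share_def e(2) by simp
          then have sum: "of_nat (val n') / of_nat (val d') =
              (of_nat (val n) / of_nat (val d) + share (a, b, k) :: rat)"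
            using e_pos us(6) by (simp add: n'(3,4) field_simps)
          show "I qs (stk (sum_st (cells (map fraction_word qs)) (counts (map (snd \<circ> snd) qs))
              [] [] [] [] n' d' [] [] [] out))"
            unfolding I_def
          proof (rule exI[of _ "us @ [(a, b, k)]"], rule exI[of _ n'], rule exI[of _ d'], intro conjI)
            show "of_nat (val n') / of_nat (val d') = sum_list (map share (us @ [(a, b, k)]))"
              unfolding sum us(7) by simp
          qed (use n' us(1,6) e_pos in simp_all)
        qed (use abk us e bound digits_binary in \<open>auto simp: g_def\<close>)
      qed (use abk gL digits_binary in \<open>auto simp: g_def\<close>)
    qed (use abk gL digits_binary in \<open>auto simp: g_def\<close>)
    moreover have "peek (binary a @ w) \<noteq> 0" for w
      using digits_binary[of a] by (cases "binary a") auto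
    ultimately show "tops ts Scan \<noteq> 0 \<and> wp L (read_share ;; scale_denom ;; add_share) (I qs) ts"
      by (simp add: ts)
  qed (use L in auto)
qed

definition put :: "reg \<Rightarrow> reg cmd" where
  "put s =
    pour (\<lambda>a. a \<noteq> 0) s MulP ;;
    drop_while (\<lambda>a. a = 1) MulP ;;
    If (\<lambda>r. r MulP = 0) (push Output (\<lambda>_. 1)) Skip ;;
    pour (\<lambda>a. a \<noteq> 0) MulP Output"

lemma wf_put [simp]: "wf_cmd (put s)"
  by (simp add: put_def)

lemma wp_put:
  assumes s: "s \<noteq> MulP" "s \<noteq> Output" "\<sigma> MulP = []" "digits (\<sigma> s)" "length (\<sigma> s) \<le> L"
    and Q: "Q (stk (\<sigma>(s := [], Output := rev (binary (val (\<sigma> s))) @ \<sigma> Output)))"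
  shows "wp L (put s) Q (stk \<sigma>)"
proof -
  define ys where "ys = dropWhile (\<lambda>a. a = 1) (rev (\<sigma> s))"
  define zs where "zs = takeWhile (\<lambda>a. a = 1) (rev (\<sigma> s))"
  define \<tau> where "\<tau> = \<sigma>(s := [], MulP := ys)"
  have split: "rev (\<sigma> s) = zs @ ys" by (simp add: ys_def zs_def)
  have ys_sub: "set ys \<subseteq> set (\<sigma> s)" using arg_cong[OF split, of set] by auto
  then have ys: "digits ys" using s(4) by blast
  have len: "length zs + length ys \<le> L" using arg_cong[OF split, of length] s(5) by simp
  have hd_ys: "hd ys = 2" if "ys \<noteq> []"
  proof -
    have "hd ys \<noteq> 1" using that hd_dropWhile unfolding ys_def by blast
    then show ?thesis using ys that by (cases ys) auto
  qed
  have binary: "binary (val (\<sigma> s)) = (if ys = [] then [1] else ys)"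
  proof -
    have val: "val (rev ys) = val (\<sigma> s)" unfolding ys_def val_strip by simp
    show ?thesis
    proof (cases "ys = []")
      case True
      then show ?thesis by (simp add: binary_less_2 flip: val)
    next
      case False
      then show ?thesis using binary_val_rev[OF ys False hd_ys] val by simp
    qed
  qed
  have fin: "wp L (pour (\<lambda>a. a \<noteq> 0) MulP Output) Q
      (stk (\<tau>(Output := (if ys = [] then [1] else []) @ \<sigma> Output)))"
  proof (rule wp_pour[where xs = ys and ys = "[]"])
    have "\<tau>(Output := (if ys = [] then [1] else []) @ \<sigma> Output, MulP := [],
        Output := rev ys @ (if ys = [] then [1] else []) @ \<sigma> Output) =
        \<sigma>(s := [], Output := rev (binary (val (\<sigma> s))) @ \<sigma> Output)"
      using s by (auto simp: \<tau>_def binary fun_eq_iff)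
    then show "Q (stk (\<tau>(Output := (if ys = [] then [1] else []) @ \<sigma> Output, MulP := [],
        Output := rev ys @ (\<tau>(Output := (if ys = [] then [1] else []) @ \<sigma> Output)) Output)))"
      using Q by simp
  qed (use s ys len in \<open>auto simp: \<tau>_def\<close>)
  have \<tau>: "\<tau> MulP = ys" "\<tau> Output = \<sigma> Output" using s by (auto simp: \<tau>_def)
  have "peek ys = 0 \<longleftrightarrow> ys = []" using hd_ys by (cases ys) auto
  then have "wp L (If (\<lambda>r. r MulP = 0) (push Output (\<lambda>_. 1)) Skip)
      (wp L (pour (\<lambda>a. a \<noteq> 0) MulP Output) Q) (stk \<tau>)"
    using fin by (auto simp: \<tau>(1) simp flip: \<tau>(2))
  moreover have "\<sigma>(s := [], MulP := rev (\<sigma> s), MulP := ys) = \<tau>" by (simp add: \<tau>_def)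
  ultimately have "wp L (drop_while (\<lambda>a. a = 1) MulP)
      (wp L (If (\<lambda>r. r MulP = 0) (push Output (\<lambda>_. 1)) Skip)
        (wp L (pour (\<lambda>a. a \<noteq> 0) MulP Output) Q)) (stk (\<sigma>(s := [], MulP := rev (\<sigma> s))))"
  proof (intro wp_drop_while[where xs = zs and ys = ys])
    show "\<forall>x \<in> set zs. x = 1" by (auto simp: zs_def dest: set_takeWhileD)
    show "peek ys \<noteq> 1" using hd_ys by (cases ys) auto
  qed (use len split in \<open>simp_all del: wp.simps\<close>)
  then show ?thesis
    unfolding put_def wp.simps(3)
    by (intro wp_pour[where xs = "\<sigma> s" and ys = "[]" and t = MulP])
      (use s in \<open>auto dest: digits_neq(1) simp del: wp.simps\<close>)
qed

section \<open>The expected utility\<close>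

text \<open>\<open>like_item\<close> does not depend on the allocation built so far, and
  distinctness prevents a later overwriting of entry \<open>k\<close>. So the recipient of
  \<open>k\<close> is distributed as in a single draw.\<close>

lemma map_pmf_like_run:
  assumes "distinct ks"
  shows "map_pmf (\<lambda>\<pi>. \<pi> k) (like_run n v ks \<pi>0) =
    (if k \<in> set ks then like_item n v k else return_pmf (\<pi>0 k))"
  using assms
proof (induction ks arbitrary: \<pi>0)
  case (Cons k' ks)
  then show ?case
    by (cases "k = k'") (auto simp: map_bind_pmf bind_return_pmf' bind_pmf_const)
qed simp

lemma finite_set_like_run: "finite (set_pmf (like_run n v ks \<pi>))"
proof (induction ks arbitrary: \<pi>)
  case (Cons k ks)
  have "finite (bidders n v k)" by (simp add: bidders_def)
  then have "finite (set_pmf (like_item n v k))" by (simp add: like_item_def)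
  then show ?case using Cons by simp
qed simp

lemma pmf_like_item:
  assumes "i < n"
  shows "pmf (like_item n v k) (Some i) =
    (if v i k > 0 then 1 / real (card (bidders n v k)) else 0)"
proof -
  have fin: "finite (bidders n v k)" by (simp add: bidders_def)
  have mem: "i \<in> bidders n v k \<longleftrightarrow> v i k > 0" using assms by (simp add: bidders_def)
  show ?thesis
  proof (cases "bidders n v k = {}")
    case True
    then show ?thesis using mem by (simp add: like_item_def)
  next
    case False
    then show ?thesis using fin mem
      by (simp add: like_item_def pmf_map_inj' indicator_def)
  qed
qed

text \<open>Linearity of expectation: after exchanging the sums, only the marginal probability that
  item \<open>k\<close> goes to agent \<open>i\<close> remains.\<close>

lemma expected_util_eq_sum:
  assumes "wf_instance I" "i < num_agents I"
  shows "expected_util I i =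
    of_rat (\<Sum>k<num_items I. util I i k / of_nat (card (bidders (num_agents I) (util I) k)))"
proof -
  let ?m = "num_items I"
  let ?P = "like I"
  have fin: "finite (set_pmf ?P)" unfolding like_def by (rule finite_set_like_run)
  have prob: "(\<Sum>\<pi>\<in>set_pmf ?P. pmf ?P \<pi> * indicator {\<pi>. \<pi> k = Some i} \<pi>) =
      pmf (like_item (num_agents I) (util I) k) (Some i)" if "k < ?m" for k
  proof -
    have "k \<in> set (arrival I)" "distinct (arrival I)"
      using assms that by (auto simp: wf_instance_def)
    then have "like_item (num_agents I) (util I) k = map_pmf (\<lambda>\<pi>. \<pi> k) ?P"
      unfolding like_def by (simp add: map_pmf_like_run)
    then have "pmf (like_item (num_agents I) (util I) k) (Some i) =
        measure_pmf.prob ?P {\<pi>. \<pi> k = Some i}"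
      by (simp add: pmf_map vimage_def)
    also have "\<dots> = measure_pmf.expectation ?P (indicator {\<pi>. \<pi> k = Some i})" by simp
    also have "\<dots> = (\<Sum>\<pi>\<in>set_pmf ?P. pmf ?P \<pi> * indicator {\<pi>. \<pi> k = Some i} \<pi>)"
      by (subst integral_measure_pmf[OF fin]) auto
    finally show ?thesis by simp
  qed
  \<comment> \<open>If the utility is positive, the agent is a bidder and the probability is 1 over
    their number. Otherwise the utility is 0 and both sides vanish, also where there are no bidders
    and HOL divides by 0.\<close>
  have summand: "real_of_rat (util I i k) * pmf (like_item (num_agents I) (util I) k) (Some i) =
      of_rat (util I i k / of_nat (card (bidders (num_agents I) (util I) k)))" if "k < ?m" for k
    using assms that unfolding wf_instance_def
    by (auto simp: pmf_like_item of_rat_divide not_less intro: antisym)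
  have util: "real_of_rat (alloc_util I i \<pi>) =
      (\<Sum>k<?m. of_rat (util I i k) * indicator {\<pi>. \<pi> k = Some i} \<pi>)" for \<pi>
    unfolding alloc_util_def of_rat_sum
    by (intro sum.mono_neutral_cong_left) (auto simp: indicator_def)
  have "expected_util I i = (\<Sum>\<pi>\<in>set_pmf ?P. \<Sum>k<?m.
      of_rat (util I i k) * (pmf ?P \<pi> * indicator {\<pi>. \<pi> k = Some i} \<pi>))"
    unfolding expected_util_def util sum_distrib_left by (intro sum.cong refl) simp
  also have "\<dots> = (\<Sum>k<?m. of_rat (util I i k) *
      (\<Sum>\<pi>\<in>set_pmf ?P. pmf ?P \<pi> * indicator {\<pi>. \<pi> k = Some i} \<pi>))"
    by (subst sum.swap) (simp add: sum_distrib_left)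
  also have "\<dots> = (\<Sum>k<?m. of_rat (util I i k / of_nat (card (bidders (num_agents I) (util I) k))))"
    by (intro sum.cong) (simp_all add: prob summand)
  finally show ?thesis by (simp add: of_rat_sum)
qed

section \<open>The program\<close>

text \<open>The machine model requires \<open>Input\<close> in front and \<open>Output\<close> at
  the end.\<close>

definition regs :: "reg list" where
  "regs = [Input, Scan, Unary, UnaryTemp, Counts, CountsTemp, Row, Numer, Denom, Count, Scaled,
    SumN, SumD, NewN, NewD, AddZ, AddY, Carry, MulP, Output]"

lemma regs: "distinct regs" "set regs = UNIV" "last regs = Output"
proof -
  show "set regs = UNIV"
  proof (intro equalityI subsetI)
    fix r :: reg
    show "r \<in> set regs" by (cases r) (simp_all add: regs_def)
  qed simp
qed (simp_all add: regs_def)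

text \<open>Pouring \<open>Input\<close> into \<open>Scan\<close> puts the first input symbol on
  top. The pushed \<open>2\<close> is the initial denominator 1, and the \<open>3\<close> is the
  slash of the output.\<close>

definition exact_utility_program :: "reg cmd" where
  "exact_utility_program =
    init_heads ;; pour (\<lambda>a. a \<noteq> 0) Input Scan ;;
    read_agent ;; read_order ;; read_rows ;;
    pour (\<lambda>a. a \<noteq> 0) Row Scan ;; push SumD (\<lambda>_. 2) ;;
    sum_shares ;; put SumN ;; push Output (\<lambda>_. 3) ;; put SumD"

lemma wf_exact_utility_program: "wf_cmd exact_utility_program"
  by (simp add: exact_utility_program_def)

lemma length_le_concat: "x \<in> set xs \<Longrightarrow> length (f x) \<le> length (concat (map f xs))"
  by (induction xs) auto

lemma wp_exact_utility_program:
  fixes ps :: "(nat \<times> nat \<times> nat) list"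
  assumes w: "w = binary i @ 5 # items @ 5 # concat (map (\<lambda>r. cells r @ [5]) X)"
      "0 \<notin> set w" "length w \<le> L"
    and items: "5 \<notin> set items" "count_list items 4 = m"
    and X: "\<And>r. r \<in> set X \<Longrightarrow> length r = m"
      "\<And>r x. r \<in> set X \<Longrightarrow> x \<in> set r \<Longrightarrow> x \<noteq> [] \<and> set x \<subseteq> {1, 2, 3} \<and> length x \<le> L"
    and i: "i < length X"
    and ps: "X ! i = map fraction_word ps" "map (column_count X) [0..<m] = map (snd \<circ> snd) ps"
      "\<And>a b k. (a, b, k) \<in> set ps \<Longrightarrow>
        b > 0 \<and> length (binary a) \<le> h \<and> length (binary b) \<le> h \<and> k \<le> h"
    and L: "length X \<le> L" "m \<le> L" "m * (length X + 1) \<le> L" "1 + 3 * (2 * h + 1) * m < L"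
  shows "wp L exact_utility_program (\<lambda>ts. \<exists>v.
    rat_code v (sum_list (map share ps)) \<and> snd (ts Output) = word_tape v) (init_tapes w)"
proof -
  let ?Q = "\<lambda>ts. \<exists>v. rat_code v (sum_list (map share ps)) \<and> snd (ts Output) = word_tape v"
  let ?rows = "concat (map (\<lambda>r. cells r @ [5]) X)"
  have len_ps: "length ps = m" using X(1)[OF nth_mem[OF i]] ps(1) by simp
  have "(\<lambda>_. [])(Input := rev w) = read_st (rev w) [] [] [] [] [] []"
    by (auto simp: read_st_def fun_eq_iff)
  then have init: "stk ((\<lambda>_. [])(Input := rev w)) = stk (read_st (rev w) [] [] [] [] [] [])" by simp
  \<comment> \<open>Between the phases only \<open>Scan\<close> and \<open>Counts\<close> are
    nonempty, so the state has both normal forms.\<close>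
  have "read_st [] (cells (X ! i)) [] [] c [] [] = sum_st (cells (X ! i)) c [] [] [] [] [] [] [] [] [] []"
    for c by (auto simp: read_st_def sum_st_def fun_eq_iff)
  then have AB: "stk (read_st [] (cells (X ! i)) [] [] c [] []) =
      stk (sum_st (cells (X ! i)) c [] [] [] [] [] [] [] [] [] [])" for c by simp
  have row_len: "length (cells (X ! i)) \<le> length w"
  proof -
    have "length (cells (X ! i) @ [5]) \<le> length ?rows"
      by (rule length_le_concat) (use i in simp)
    then show ?thesis using w(1) by simp
  qed
  have row_pos: "\<forall>x \<in> set (cells (X ! i)). x \<noteq> 0"
  proof -
    have "0 \<notin> set x" if "x \<in> set (X ! i)" for x using X(2)[OF nth_mem[OF i] that] by auto
    then have "0 \<notin> set (cells (X ! i))" by (auto simp: cells_def)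
    then show ?thesis by metis
  qed
  \<comment> \<open>From here on the phases are treated from the last to the first; each fact is the
    continuation needed by the next one.\<close>
  have out: "wp L (put SumN) (wp L (push Output (\<lambda>_. 3)) (wp L (put SumD) ?Q))
      (stk (sum_st [] [] [] [] [] [] n d [] [] [] []))"
    if nd: "digits n" "digits d" "length n < L" "length d < L" "val d > 0"
      "of_nat (val n) / of_nat (val d) = sum_list (map share ps)" for n d
  proof -
    have "rat_code (binary (val n) @ [slash] @ binary (val d)) (sum_list (map share ps))"
      unfolding rat_code_def nd(6)[symmetric] using nd(5) by blast
    then have "?Q (stk (sum_st [] [] [] [] [] [] [] [] [] [] []
        (rev (binary (val d)) @ 3 # rev (binary (val n)))))"
      by (intro exI[of _ "binary (val n) @ [slash] @ binary (val d)"])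
        (simp add: stk_def slash_def)
    then have "wp L (put SumD) ?Q (stk (sum_st [] [] [] [] [] [] [] d [] [] []
        (3 # rev (binary (val n)))))"
      by (intro wp_put) (use nd in simp_all)
    then show ?thesis by (intro wp_put) (use nd in simp_all)
  qed
  have sum: "wp L sum_shares (wp L (put SumN) (wp L (push Output (\<lambda>_. 3)) (wp L (put SumD) ?Q)))
      (stk (sum_st (cells (X ! i)) (counts (map (column_count X) [0..<m])) [] [] [] [] [] [2] [] [] [] []))"
    unfolding ps(1,2) by (rule wp_sum_shares[where h = h]) (use ps(3) L len_ps out in auto)
  have copy: "wp L (pour (\<lambda>a. a \<noteq> 0) Row Scan) (wp L (push SumD (\<lambda>_. 2)) (wp L sum_shares
      (wp L (put SumN) (wp L (push Output (\<lambda>_. 3)) (wp L (put SumD) ?Q)))))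
      (stk (read_st [] [] [] [] (counts (map (column_count X) [0..<m])) [] (rev (cells (X ! i)))))"
    by (rule wp_pour[where xs = "rev (cells (X ! i))" and ys = "[]"])
      (use row_len row_pos w(3) sum in \<open>simp_all add: AB\<close>)
  have rows: "wp L read_rows (wp L (pour (\<lambda>a. a \<noteq> 0) Row Scan) (wp L (push SumD (\<lambda>_. 2))
      (wp L sum_shares (wp L (put SumN) (wp L (push Output (\<lambda>_. 3)) (wp L (put SumD) ?Q))))))
      (stk (read_st [] ?rows (replicate i 1 @ [2]) [] (replicate m 4) [] []))"
    by (rule wp_read_rows) (use X i L copy in auto)
  have agent: "wp L read_agent (wp L read_order (wp L read_rows
      (wp L (pour (\<lambda>a. a \<noteq> 0) Row Scan) (wp L (push SumD (\<lambda>_. 2))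
        (wp L sum_shares (wp L (put SumN) (wp L (push Output (\<lambda>_. 3)) (wp L (put SumD) ?Q))))))))
      (stk (read_st [] w [] [] [] [] []))"
    unfolding w(1)
  proof (rule wp_read_agent)
    show "wp L read_order (wp L read_rows
      (wp L (pour (\<lambda>a. a \<noteq> 0) Row Scan) (wp L (push SumD (\<lambda>_. 2))
        (wp L sum_shares (wp L (put SumN) (wp L (push Output (\<lambda>_. 3)) (wp L (put SumD) ?Q)))))))
      (stk (read_st [] (items @ 5 # ?rows) (replicate (val (rev (binary i))) 1 @ [2]) [] [] [] []))"
      by (rule wp_read_order) (use items w rows in auto)
  qed (use digits_binary w i L in auto)
  show ?thesis
    unfolding exact_utility_program_def wp.simps(3)
  proof (rule wp_init_heads[OF w(2,3)], unfold init)
    show "wp L (pour (\<lambda>a. a \<noteq> 0) Input Scan) (wp L read_agent (wp L read_order (wp L read_rows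
      (wp L (pour (\<lambda>a. a \<noteq> 0) Row Scan) (wp L (push SumD (\<lambda>_. 2))
        (wp L sum_shares (wp L (put SumN) (wp L (push Output (\<lambda>_. 3)) (wp L (put SumD) ?Q)))))))))
      (stk (read_st (rev w) [] [] [] [] [] []))"
    proof (rule wp_pour[where xs = "rev w" and ys = "[]"])
      show "\<forall>x \<in> set (rev w). x \<noteq> 0" using w(2) by (metis set_rev)
    qed (use w(3) agent in simp_all)
  qed
qed

lemma length_le_concat_map:
  "(\<And>x. x \<in> set xs \<Longrightarrow> f x \<noteq> []) \<Longrightarrow> length xs \<le> length (concat (map f xs))"
proof (induction xs)
  case (Cons x xs)
  then show ?case by (cases "f x") auto
qed simp

text \<open>With l the input length, the numbers of items and agents, the cell lengths and the
  counts are at most l. The counters need l * (l + 1), and the numbers need more than 1 + 3 * (2 * l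
  + 1) * l = 6 * l^2 + 3 * l + 1; \<open>L\<close> covers both.\<close>

lemma instance_code_run:
  assumes code: "instance_code w (I, i)" and I: "wf_instance I" "i < num_agents I"
    and L: "L = 6 * length w * length w + 4 * length w + 3"
  shows "wp L exact_utility_program (\<lambda>ts. \<exists>v.
    real_code v (expected_util I i) \<and> snd (ts Output) = word_tape v) (init_tapes w)"
proof -
  let ?n = "num_agents I" and ?m = "num_items I"
  obtain W where W: "\<And>j k. j < ?n \<Longrightarrow> k < ?m \<Longrightarrow> rat_code (W j k) (util I j k)"
    and w: "w = binary i @ [semicolon] @ concat (map (\<lambda>k. binary k @ [comma]) (arrival I)) @
        [semicolon] @ concat (map (\<lambda>j. concat (map (\<lambda>k. W j k @ [comma]) [0..<?m]) @ [semicolon])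
          [0..<?n])"
    using code unfolding instance_code_def by auto
  have "\<exists>a b. b > 0 \<and> util I j k = of_nat a / of_nat b \<and> W j k = binary a @ 3 # binary b"
    if "j < ?n" "k < ?m" for j k
    using W[OF that] unfolding rat_code_def by (auto simp: slash_def)
  then obtain a b where ab: "\<And>j k. j < ?n \<Longrightarrow> k < ?m \<Longrightarrow>
      b j k > 0 \<and> util I j k = of_nat (a j k) / of_nat (b j k) \<and>
      W j k = binary (a j k) @ 3 # binary (b j k)"
    by metis
  define X where "X = map (\<lambda>j. map (W j) [0..<?m]) [0..<?n]"
  define items where "items = concat (map (\<lambda>k. binary k @ [4]) (arrival I))"
  define ps where "ps = map (\<lambda>k. (a i k, b i k, column_count X k)) [0..<?m]"
  have w_eq: "w = binary i @ 5 # items @ 5 # concat (map (\<lambda>r. cells r @ [5]) X)"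
    unfolding w X_def items_def cells_def by (simp add: comp_def semicolon_def comma_def)
  have set_binary: "set (binary k) \<subseteq> {1, 2}" for k by (rule digits_binary)
  have sub_W: "W j k \<noteq> []" "set (W j k) \<subseteq> {1, 2, 3}" if "j < ?n" "k < ?m" for j k
    using ab[OF that] set_binary[of "a j k"] set_binary[of "b j k"] by auto
  have sub_items: "set items \<subseteq> {1, 2, 4}" by (auto simp: items_def dest!: subsetD[OF set_binary])
  have "0 \<notin> set (W j k)" if "j < ?n" "k < ?m" for j k
    using sub_W(2)[OF that] by auto
  then have "0 \<notin> set (concat (map (\<lambda>r. cells r @ [5]) X))"
    by (auto simp: X_def cells_def)
  then have pos: "0 \<notin> set w"
    using set_binary[of i] sub_items unfolding w_eq by auto
  have len_items: "count_list items 4 = ?m"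
  proof -
    have "count_list (binary k) 4 = 0" for k
      using set_binary[of k] by (intro count_list_0_iff[THEN iffD2]) auto
    then have "count_list (concat (map (\<lambda>k. binary k @ [4]) ks)) 4 = length ks" for ks
      by (induction ks) auto
    moreover have "length (arrival I) = ?m"
      using I(1) distinct_card[of "arrival I"] by (simp add: wf_instance_def)
    ultimately show ?thesis by (simp add: items_def)
  qed
  have "?m \<le> length items" using len_items count_le_length[of items 4] by simp
  \<comment> \<open>Each row ends with a semicolon, so the number of agents is bounded by the input
    length even if there are no items.\<close>
  moreover have n: "?n \<le> length (concat (map (\<lambda>r. cells r @ [5]) X))"
    using length_le_concat_map[of X "\<lambda>r. cells r @ [5]"] by (simp add: X_def)
  ultimately have mn: "?m \<le> length w" "?n \<le> length w" by (simp_all add: w_eq)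
  have len_W: "length (W j k) \<le> length w" if "j < ?n" "k < ?m" for j k
  proof -
    have "length (W j k @ [4]) \<le> length (cells (map (W j) [0..<?m]))"
      unfolding cells_def by (rule length_le_concat) (use that in simp)
    moreover have "length (cells (map (W j) [0..<?m]) @ [5]) \<le>
        length (concat (map (\<lambda>r. cells r @ [5]) X))"
      by (rule length_le_concat) (use that in \<open>auto simp: X_def\<close>)
    ultimately show ?thesis by (simp add: w_eq)
  qed
  have pos_iff: "hd (W j k) = 2 \<longleftrightarrow> util I j k > 0" if "j < ?n" "k < ?m" for j k
    using ab[OF that] by (auto simp: hd_append hd_binary zero_less_divide_iff)
  have count: "column_count X k = card (bidders ?n (util I) k)" if "k < ?m" for k
    unfolding column_count_def length_filter_conv_card bidders_def
    by (rule arg_cong[of _ _ card]) (use that pos_iff in \<open>auto simp: X_def\<close>)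
  have count_le: "column_count X k \<le> length w" for k
    using column_count_le[of X k] mn(2) by (simp add: X_def)
  have "wp L exact_utility_program (\<lambda>ts. \<exists>v.
    rat_code v (sum_list (map share ps)) \<and> snd (ts Output) = word_tape v) (init_tapes w)"
  proof (rule wp_exact_utility_program[OF w_eq pos, where h = "length w" and m = ?m])
    show "5 \<notin> set items" using sub_items by auto
    show "X ! i = map fraction_word ps"
      using I(2) ab by (auto simp: X_def ps_def fraction_word_def)
    show "map (column_count X) [0..<?m] = map (snd \<circ> snd) ps" by (simp add: ps_def)
    show "b' > 0 \<and> length (binary a') \<le> length w \<and> length (binary b') \<le> length w \<and> k \<le> length w"
      if "(a', b', k) \<in> set ps" for a' b' k
      using that ab[OF I(2)] len_W[OF I(2)] count_le by (fastforce simp: ps_def)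
    show "x \<noteq> [] \<and> set x \<subseteq> {1, 2, 3} \<and> length x \<le> L" if "r \<in> set X" "x \<in> set r" for r x
      using that sub_W len_W L by (fastforce simp: X_def)
    have "?m * (?n + 1) \<le> length w * (length w + 1)" using mn by (intro mult_le_mono) auto
    then show "?m * (length X + 1) \<le> L" using L by (simp add: X_def algebra_simps)
    have "3 * (2 * length w + 1) * ?m \<le> 3 * (2 * length w + 1) * length w"
      using mn by (intro mult_le_mono) auto
    then show "1 + 3 * (2 * length w + 1) * ?m < L" using L by (simp add: algebra_simps)
  qed (use L mn len_items I(2) in \<open>auto simp: X_def\<close>)
  moreover have "sum_list (map share ps) =
      (\<Sum>k<?m. util I i k / of_nat (card (bidders ?n (util I) k)))"
  proof -
    have "share (a i k, b i k, column_count X k) =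
        util I i k / of_nat (card (bidders ?n (util I) k))" if k: "k < ?m" for k
    \<comment> \<open>A positive utility makes agent \<open>i\<close> a bidder, so raising the count
      to at least 1 changes nothing. Otherwise the numerator is 0.\<close>
    proof (cases "util I i k > 0")
      case True
      then have "i \<in> bidders ?n (util I) k" using I(2) by (simp add: bidders_def)
      moreover have "finite (bidders ?n (util I) k)" by (simp add: bidders_def)
      ultimately have "card (bidders ?n (util I) k) \<ge> 1" by (metis One_nat_def Suc_leI card_gt_0_iff empty_iff)
      then show ?thesis using ab[OF I(2) k] count[OF k] by (simp add: share_def max_def)
    next
      case False
      then have "a i k = 0" using ab[OF I(2) k] by (auto simp: not_less divide_le_0_iff)
      then show ?thesis using ab[OF I(2) k] by (simp add: share_def)
    qed
    then have "sum_list (map share ps) =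
        sum_list (map (\<lambda>k. util I i k / of_nat (card (bidders ?n (util I) k))) [0..<?m])"
      unfolding ps_def by (intro arg_cong[of _ _ sum_list]) simp
    then show ?thesis by (simp add: interv_sum_list_conv_sum_set_nat atLeast0LessThan)
  qed
  then have "expected_util I i = of_rat (sum_list (map share ps))"
    using expected_util_eq_sum[OF I] by simp
  ultimately show ?thesis
    by (auto simp: real_code_def elim!: wp_mono)
qed

theorem mainTheorem7:
  "poly_time_computable instance_code real_code exact_utility_inputs exact_utility"
proof -
  have nontrivial: "exact_utility_program \<noteq> Skip" by (simp add: exact_utility_program_def)
  obtain M where M: "wf_tm M" "tapes M = length regs"
    "\<And>L P ts w. wp L exact_utility_program (\<lambda>ts. \<exists>v. P v \<and> snd (ts (last regs)) = word_tape v) ts \<Longrightarrow>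
      init_config M w = (0, map ts regs) \<Longrightarrow>
      \<exists>v. P v \<and> computes_within M (cost L exact_utility_program) w v"
    by (rule compile[OF regs(1,2) wf_exact_utility_program nontrivial]) (rule that)
  \<comment> \<open>The polynomial 6 n^2 + 4 n + 3 is the loop bound \<open>L\<close> for inputs of
    length n.\<close>
  obtain p where p: "\<And>n. cost (poly [:3, 4, 6:] n) exact_utility_program = poly p n"
    using cost_poly by blast
  have "\<exists>v. real_code v (exact_utility x) \<and> computes_within M (poly p (length w)) w v"
    if x: "x \<in> exact_utility_inputs" "instance_code w x" for x w
  proof -
    obtain I i where Ii: "x = (I, i)" "wf_instance I" "i < num_agents I"
      using x(1) by (auto simp: exact_utility_inputs_def)
    define L where "L = 6 * length w * length w + 4 * length w + 3"
    have L: "cost L exact_utility_program = poly p (length w)"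
      by (simp add: L_def algebra_simps flip: p)
    have "init_config M w = (0, map (init_tapes w) regs)"
      unfolding init_config_def M(2) by (simp add: regs_def init_tapes_def)
    then show ?thesis
      using M(3)[of L "\<lambda>v. real_code v (expected_util I i)" "init_tapes w" w]
        instance_code_run[OF x(2)[unfolded Ii(1)] Ii(2,3) L_def]
      by (simp add: regs(3) L exact_utility_def Ii(1))
  qed
  then show ?thesis unfolding poly_time_computable_def using M(1) by blast
qed

end
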